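(* Let $R$ be a commutative ring with $1$, let $k,l\in\mathbb{N}\setminus\{0\}$, and let $\Lambda$ be the standard $k$-graph of level $l$. Let $\mathcal{R}\subseteq\mathcal{A}$ be a set consisting of one arbitrarily chosen representative from each $\sim$-equivalence class of $\mathcal{A}$. Then the elements $v$ $(v\in\Lambda^0)$, $\lambda$ $(\lambda\in\Lambda^{\neq 0})$, $\lambda^*$ $(\lambda\in\Lambda^{\neq 0})$ and $\lambda\mu^*$ $((\lambda,\mu)\in\mathcal{R})$ form a basis of the Kumjian-Pask algebra $KP_R(\Lambda)$ as an $R$-module.
   Context: Notation: $\mathbb{N}$ contains $0$. For $m,n\in\mathbb{Z}^k$, $m\le n$ is the componentwise order, $m\lor n$ and $m\land n$ are the componentwise maximum and minimum, and $|m|:=m_1+\dots+m_k$. Level tuples: $\{1,\dots,l\}^s$ is the $s$-fold cartesian product, with $\{1,\dots,l\}^0=\{()\}$. For $p=(p_s,\dots,p_1)$ and $q=(q_t,\dots,q_1)$, $p\times q:=(p_s,\dots,p_1,q_t,\dots,q_1)$ denotes concatenation. Standard $k$-graph of level $l$: $\Lambda^0:=\mathbb{Z}^k$ and $\Lambda:=\{(v,w,p)\mid v,w\in\mathbb{Z}^k,\ v\ge w,\ p\in\{1,\dots,l\}^{|v-w|}\}$, with range $r(v,w,p)=v$, source $s(v,w,p)=w$, composition $(u,v,p)\circ(v,w,q)=(u,w,p\times q)$ (so $\lambda\circ\mu$ is defined when $s(\lambda)=r(\mu)$), and degree $d(v,w,p)=v-w\in\mathbb{N}^k$. An object $v\in\Lambda^0$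 is identified with its identity morphism $(v,v,())$. For $n\in\mathbb{N}^k$, $v\Lambda^n$ is the set of $\lambda\in\Lambda$ with $r(\lambda)=v$ and $d(\lambda)=n$. Set $\Lambda^{\neq 0}:=\{\lambda\in\Lambda\mid d(\lambda)\ne 0\}$. Kumjian-Pask algebra: for each $\lambda\in\Lambda^{\neq 0}$ introduce a ghost path $\lambda^*$ (a new symbol; $\lambda\mapsto\lambda^*$ is injective and no ghost path lies in $\Lambda$), and set $v^*:=v$ for $v\in\Lambda^0$. $KP_R(\Lambda)$ is the associative, not necessarily unital, $R$-algebra presented by the generators $\Lambda^0\cup\Lambda^{\neq 0}\cup(\Lambda^{\neq 0})^*$ and the relations: (KP1) $\{v\in\Lambda^0\}$ is a family of mutually orthogonal idempotents; (KP2) for all $\lambda,\mu\in\Lambda^{\neq 0}$ with $r(\mu)=s(\lambda)$: $\lambda\mu=\lambda\circ\mu$, $\mu^*\lambda^*=(\lambda\circ\mu)^*$, $r(\lambda)\lambda=\lambda=\lambda s(\lambda)$, $s(\lambda)\lambda^*=\lambda^*=\lambda^* r(\lambda)$; (KP3) for all $\lambda,\mu\in\Lambda^{\neq 0}$ with $d(\lambda)=d(\mu)$: $\lambda^*\mu=\delta_{\lambda,\mu}s(\lambda)$; (KP4) for all $v\in\Lambda^0$ and $n\in\mathbb{N}^k\setminus\{0\}$: $v=\sum_{\lambda\in v\Lambda^n}\lambda\lambda^*$. For $v\in\Lambda^0$ and $n\in\mathbb{N}^k\setminus\{0\}$ set $\lambda^{v,n}:=(v,v-n,(1,\dots,1))\in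 v\Lambda^n$; write $\mu\circ\lambda^{\sim,n}$ for $\mu\circ\lambda^{s(\mu),n}$. $\hat{\mathcal{A}}:=\{(\lambda,\mu)\mid\lambda,\mu\in\Lambda^{\neq 0},\ s(\lambda)=s(\mu)\}$, and $\mathcal{A}$ is the set of $(\lambda,\mu)\in\hat{\mathcal{A}}$ for which there are no $n\in\mathbb{N}^k\setminus\{0\}$ and $\lambda',\mu'\in\Lambda$ with $\lambda=\lambda'\circ\lambda^{\sim,n}$ and $\mu=\mu'\circ\lambda^{\sim,n}$. For $(\lambda,\mu),(\lambda',\mu')\in\mathcal{A}$ write $(\lambda,\mu)\sim(\lambda',\mu')$ iff there are $m,n\in\mathbb{N}^k\setminus\{0\}$ such that $\lambda\circ\lambda^{\sim,m}=\lambda'\circ\lambda^{\sim,n}$ and $\mu\circ\lambda^{\sim,m}=\mu'\circ\lambda^{\sim,n}$. This is an equivalence relation on $\mathcal{A}$. *)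

theory Defs
  imports "HOL-Analysis.Finite_Cartesian_Product"
begin

section \<open>The standard k-graph of level l\<close>

text \<open>
  The rank \<open>k\<close> is \<open>CARD('k)\<close> and the level \<open>l\<close> is \<open>CARD('l)\<close>, for finite types \<open>'k\<close> and \<open>'l\<close>,
  so both are arbitrary positive integers. Objects are elements of \<open>int ^ 'k\<close> with the componentwise
  order, and elements of \<open>\<nat>\<^sup>k\<close> are the nonnegative elements of \<open>int ^ 'k\<close>. A level tuple
  \<open>(p\<^sub>s, \<dots>, p\<^sub>1)\<close> is the list \<open>[p\<^sub>s, \<dots>, p\<^sub>1]\<close>, in this order, so that
  \<open>p \<times> q\<close> is \<open>p @ q\<close>.
\<close>

definition vsize :: "int ^ 'k \<Rightarrow> int" where
  "vsize m = (\<Sum>i\<in>UNIV. m $ i)"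

definition Nk :: "(int ^ 'k) set" where
  "Nk = {n. 0 \<le> n}"

typedef (overloaded) ('k::finite, 'l::finite) path =
  "{(v :: int ^ 'k, w :: int ^ 'k, p :: nat list).
      w \<le> v \<and> int (length p) = vsize (v - w) \<and> set p \<subseteq> {1..CARD('l)}}"
  by (rule exI[of _ "(0, 0, [])"]) (simp add: vsize_def)

setup_lifting type_definition_path

lift_definition rng :: "('k::finite, 'l::finite) path \<Rightarrow> int ^ 'k" is "\<lambda>(v, w, p). v" .
lift_definition src :: "('k::finite, 'l::finite) path \<Rightarrow> int ^ 'k" is "\<lambda>(v, w, p). w" .
lift_definition labels :: "('k::finite, 'l::finite) path \<Rightarrow> nat list" is "\<lambda>(v, w, p). p" .

definition deg :: "('k::finite, 'l::finite) path \<Rightarrow> int ^ 'k" where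
  "deg \<alpha> = rng \<alpha> - src \<alpha>"

lift_definition idpath :: "int ^ 'k \<Rightarrow> ('k::finite, 'l::finite) path" is "\<lambda>v. (v, v, [])"
  by (simp add: vsize_def)

text \<open>
  The composition \<open>\<alpha> \<circ> \<mu>\<close>, meaningful if \<open>src \<alpha> = rng \<mu>\<close>; the identity at \<open>rng \<alpha>\<close> is a dummy value.
\<close>

lift_definition pcomp :: "('k::finite, 'l::finite) path \<Rightarrow> ('k, 'l) path \<Rightarrow> ('k, 'l) path"
    (infixl \<open>\<cdot>\<close> 75)
  is "\<lambda>(u, v, p) (v', w, q). if v = v' then (u, w, p @ q) else (u, u, [])"
  by (auto simp: vsize_def sum_subtractf subset_eq split: if_splits)

text \<open>The path \<open>\<lambda>\<^sup>v\<^sup>,\<^sup>n\<close>, meaningful if \<open>n \<in> Nk\<close>.\<close>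

lift_definition onepath :: "int ^ 'k \<Rightarrow> int ^ 'k \<Rightarrow> ('k::finite, 'l::finite) path"
  is "\<lambda>v n. if 0 \<le> n then (v, v - n, replicate (nat (vsize n)) 1) else (v, v, [])"
  by (auto simp: vsize_def less_eq_vec_def Suc_le_eq intro!: sum_nonneg)

definition paths_from :: "int ^ 'k \<Rightarrow> int ^ 'k \<Rightarrow> ('k::finite, 'l::finite) path set" where
  "paths_from v n = {\<alpha>. rng \<alpha> = v \<and> deg \<alpha> = n}"

definition nonzero_paths :: "('k::finite, 'l::finite) path set" where
  "nonzero_paths = {\<alpha>. deg \<alpha> \<noteq> 0}"

lemma rng_pcomp: "src \<alpha> = rng \<mu> \<Longrightarrow> rng (\<alpha> \<cdot> \<mu>) = rng \<alpha>"
  by transfer auto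

lemma src_pcomp: "src \<alpha> = rng \<mu> \<Longrightarrow> src (\<alpha> \<cdot> \<mu>) = src \<mu>"
  by transfer auto

lemma labels_pcomp: "src \<alpha> = rng \<mu> \<Longrightarrow> labels (\<alpha> \<cdot> \<mu>) = labels \<alpha> @ labels \<mu>"
  by transfer auto

lemma rng_onepath: "rng (onepath v n) = v"
  by transfer auto

lemma deg_onepath: "n \<in> Nk \<Longrightarrow> deg (onepath v n) = n"
  unfolding deg_def Nk_def by transfer auto

lemma path_eqI: "rng \<alpha> = rng \<mu> \<Longrightarrow> src \<alpha> = src \<mu> \<Longrightarrow> labels \<alpha> = labels \<mu> \<Longrightarrow> \<alpha> = \<mu>"
  by transfer auto

lemma set_labels: "set (labels (\<alpha> :: ('k::finite, 'l::finite) path)) \<subseteq> {1..CARD('l)}"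
  by transfer auto

lemma length_labels: "int (length (labels \<alpha>)) = vsize (deg \<alpha>)"
  unfolding deg_def by transfer auto

lemma finite_paths_from: "finite (paths_from v n :: ('k::finite, 'l::finite) path set)"
proof (rule finite_imageD)
  have "labels ` (paths_from v n :: ('k, 'l) path set)
      \<subseteq> {p. set p \<subseteq> {1..CARD('l)} \<and> length p = nat (vsize n)}"
  proof safe
    fix \<alpha> :: "('k, 'l) path" and x
    assume "\<alpha> \<in> paths_from v n" "x \<in> set (labels \<alpha>)"
    then show "x \<in> {1..CARD('l)}"
      using set_labels[of \<alpha>] by blast
  next
    fix \<alpha> :: "('k, 'l) path"
    assume "\<alpha> \<in> paths_from v n"
    then show "length (labels \<alpha>) = nat (vsize n)"
      using length_labels[of \<alpha>] by (simp add: paths_from_def)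
  qed
  then show "finite (labels ` (paths_from v n :: ('k, 'l) path set))"
    by (rule finite_subset) (simp add: finite_lists_length_eq)
  show "inj_on labels (paths_from v n :: ('k, 'l) path set)"
    by (auto simp: inj_on_def paths_from_def deg_def intro!: path_eqI) 
qed


section \<open>Algebras presented by generators and relations\<close>

text \<open>
  The associative, not necessarily unital, \<open>'r\<close>-algebra with generators \<open>'g\<close> and relations \<open>rel\<close>
  is the set of formal expressions modulo the least congruence that contains \<open>rel\<close> and makes the
  quotient an associative algebra. The sort \<open>{comm_ring, comm_monoid_mult}\<close> is that of commutative
  rings with one, including the zero ring, which \<open>comm_ring_1\<close> excludes.
\<close>

datatype ('r, 'g) alg_term =
    Gen 'g
  | Zero
  | Neg "('r, 'g) alg_term"
  | Add "('r, 'g) alg_term" "('r, 'g) alg_term"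
  | Scale 'r "('r, 'g) alg_term"
  | Mul "('r, 'g) alg_term" "('r, 'g) alg_term"

inductive alg_eq ::
  "(('r::{comm_ring, comm_monoid_mult}, 'g) alg_term \<Rightarrow> ('r, 'g) alg_term \<Rightarrow> bool) \<Rightarrow>
     ('r, 'g) alg_term \<Rightarrow> ('r, 'g) alg_term \<Rightarrow> bool"
  for rel where
  rel: "rel x y \<Longrightarrow> alg_eq rel x y"
| refl: "alg_eq rel x x"
| sym: "alg_eq rel x y \<Longrightarrow> alg_eq rel y x"
| trans: "alg_eq rel x y \<Longrightarrow> alg_eq rel y z \<Longrightarrow> alg_eq rel x z"
| cong_neg: "alg_eq rel x x' \<Longrightarrow> alg_eq rel (Neg x) (Neg x')"
| cong_add: "alg_eq rel x x' \<Longrightarrow> alg_eq rel y y' \<Longrightarrow> alg_eq rel (Add x y) (Add x' y')"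
| cong_scale: "alg_eq rel x x' \<Longrightarrow> alg_eq rel (Scale a x) (Scale a x')"
| cong_mul: "alg_eq rel x x' \<Longrightarrow> alg_eq rel y y' \<Longrightarrow> alg_eq rel (Mul x y) (Mul x' y')"
| add_assoc: "alg_eq rel (Add (Add x y) z) (Add x (Add y z))"
| add_commute: "alg_eq rel (Add x y) (Add y x)"
| add_zero: "alg_eq rel (Add Zero x) x"
| add_neg: "alg_eq rel (Add (Neg x) x) Zero"
| mul_assoc: "alg_eq rel (Mul (Mul x y) z) (Mul x (Mul y z))"
| distrib_right: "alg_eq rel (Mul (Add x y) z) (Add (Mul x z) (Mul y z))"
| distrib_left: "alg_eq rel (Mul x (Add y z)) (Add (Mul x y) (Mul x z))"
| scale_add: "alg_eq rel (Scale a (Add x y)) (Add (Scale a x) (Scale a y))"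
| add_scale: "alg_eq rel (Scale (a + b) x) (Add (Scale a x) (Scale b x))"
| scale_scale: "alg_eq rel (Scale a (Scale b x)) (Scale (a * b) x)"
| scale_one: "alg_eq rel (Scale 1 x) x"
| mul_scale_left: "alg_eq rel (Mul (Scale a x) y) (Scale a (Mul x y))"
| mul_scale_right: "alg_eq rel (Mul x (Scale a y)) (Scale a (Mul x y))"

lemma equivp_alg_eq: "equivp (alg_eq rel)"
  by (intro equivpI reflpI sympI transpI) (blast intro: alg_eq.intros)+

fun Sum_list :: "('r, 'g) alg_term list \<Rightarrow> ('r, 'g) alg_term" where
  "Sum_list [] = Zero"
| "Sum_list (x # xs) = Add x (Sum_list xs)"


section \<open>The Kumjian-Pask algebra of the standard k-graph\<close>

text \<open>Only paths of nonzero degree have a ghost path as a new symbol.\<close>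

datatype ('k::finite, 'l::finite) symbol = Path "('k, 'l) path" | Ghost "('k, 'l) path"

typedef (overloaded) ('k::finite, 'l::finite) generator =
  "range Path \<union> Ghost ` (nonzero_paths :: ('k, 'l) path set)"
  by auto

definition path_term :: "('k::finite, 'l::finite) path \<Rightarrow> ('r, ('k, 'l) generator) alg_term" where
  "path_term \<alpha> = Gen (Abs_generator (Path \<alpha>))"

definition ghost_term :: "('k::finite, 'l::finite) path \<Rightarrow> ('r, ('k, 'l) generator) alg_term" where
  "ghost_term \<alpha> = Gen (Abs_generator (if deg \<alpha> = 0 then Path \<alpha> else Ghost \<alpha>))"

abbreviation vertex_term :: "int ^ 'k \<Rightarrow> ('r, ('k::finite, 'l::finite) generator) alg_term" where
  "vertex_term v \<equiv> path_term (idpath v)"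

text \<open>
  In \<open>KP4\<close>, \<open>xs\<close> is an arbitrary enumeration of the finite set \<open>paths_from v n\<close>; see \<open>KP4_sum\<close> below.
\<close>

inductive kp_rel ::
  "('r, ('k::finite, 'l::finite) generator) alg_term \<Rightarrow>
     ('r, ('k, 'l) generator) alg_term \<Rightarrow> bool" where
  KP1_idem: "kp_rel (Mul (vertex_term v) (vertex_term v)) (vertex_term v)"
| KP1_orth: "v \<noteq> w \<Longrightarrow> kp_rel (Mul (vertex_term v) (vertex_term w)) Zero"
| KP2_comp: "\<alpha> \<in> nonzero_paths \<Longrightarrow> \<mu> \<in> nonzero_paths \<Longrightarrow> rng \<mu> = src \<alpha> \<Longrightarrow>
    kp_rel (Mul (path_term \<alpha>) (path_term \<mu>)) (path_term (\<alpha> \<cdot> \<mu>))"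
| KP2_ghost_comp: "\<alpha> \<in> nonzero_paths \<Longrightarrow> \<mu> \<in> nonzero_paths \<Longrightarrow> rng \<mu> = src \<alpha> \<Longrightarrow>
    kp_rel (Mul (ghost_term \<mu>) (ghost_term \<alpha>)) (ghost_term (\<alpha> \<cdot> \<mu>))"
| KP2_rng: "\<alpha> \<in> nonzero_paths \<Longrightarrow>
    kp_rel (Mul (vertex_term (rng \<alpha>)) (path_term \<alpha>)) (path_term \<alpha>)"
| KP2_src: "\<alpha> \<in> nonzero_paths \<Longrightarrow>
    kp_rel (Mul (path_term \<alpha>) (vertex_term (src \<alpha>))) (path_term \<alpha>)"
| KP2_ghost_src: "\<alpha> \<in> nonzero_paths \<Longrightarrow>
    kp_rel (Mul (vertex_term (src \<alpha>)) (ghost_term \<alpha>)) (ghost_term \<alpha>)"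
| KP2_ghost_rng: "\<alpha> \<in> nonzero_paths \<Longrightarrow>
    kp_rel (Mul (ghost_term \<alpha>) (vertex_term (rng \<alpha>))) (ghost_term \<alpha>)"
| KP3: "\<alpha> \<in> nonzero_paths \<Longrightarrow> \<mu> \<in> nonzero_paths \<Longrightarrow> deg \<alpha> = deg \<mu> \<Longrightarrow>
    kp_rel (Mul (ghost_term \<alpha>) (path_term \<mu>)) (if \<alpha> = \<mu> then vertex_term (src \<alpha>) else Zero)"
| KP4: "n \<in> Nk - {0} \<Longrightarrow> distinct xs \<Longrightarrow> set xs = paths_from v n \<Longrightarrow>
    kp_rel (vertex_term v) (Sum_list (map (\<lambda>\<alpha>. Mul (path_term \<alpha>) (ghost_term \<alpha>)) xs))"

quotient_type (overloaded) ('r, 'k, 'l) kp =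
  "('r::{comm_ring, comm_monoid_mult}, ('k::finite, 'l::finite) generator) alg_term" /
  "alg_eq kp_rel"
  by (rule equivp_alg_eq)

instantiation kp :: ("{comm_ring, comm_monoid_mult}", finite, finite) ring
begin

lift_definition zero_kp :: "('a, 'b, 'c) kp" is Zero .

lift_definition uminus_kp :: "('a, 'b, 'c) kp \<Rightarrow> ('a, 'b, 'c) kp" is Neg
  by (rule alg_eq.cong_neg)

lift_definition plus_kp :: "('a, 'b, 'c) kp \<Rightarrow> ('a, 'b, 'c) kp \<Rightarrow> ('a, 'b, 'c) kp" is Add
  by (rule alg_eq.cong_add)

definition minus_kp :: "('a, 'b, 'c) kp \<Rightarrow> ('a, 'b, 'c) kp \<Rightarrow> ('a, 'b, 'c) kp" where
  "minus_kp x y = x + - y"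

lift_definition times_kp :: "('a, 'b, 'c) kp \<Rightarrow> ('a, 'b, 'c) kp \<Rightarrow> ('a, 'b, 'c) kp" is Mul
  by (rule alg_eq.cong_mul)

instance
proof
  fix a b c :: "('a, 'b, 'c) kp"
  show "a + b + c = a + (b + c)" by transfer (rule alg_eq.add_assoc)
  show "a + b = b + a" by transfer (rule alg_eq.add_commute)
  show "0 + a = a" by transfer (rule alg_eq.add_zero)
  show "- a + a = 0" by transfer (rule alg_eq.add_neg)
  show "a - b = a + - b" by (rule minus_kp_def)
  show "a * b * c = a * (b * c)" by transfer (rule alg_eq.mul_assoc)
  show "(a + b) * c = a * c + b * c" by transfer (rule alg_eq.distrib_right)
  show "a * (b + c) = a * b + a * c" by transfer (rule alg_eq.distrib_left)
qed

end

lift_definition kp_scale ::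
  "'r::{comm_ring, comm_monoid_mult} \<Rightarrow> ('r, 'k::finite, 'l::finite) kp \<Rightarrow> ('r, 'k, 'l) kp"
  is Scale by (rule alg_eq.cong_scale)

lift_definition kp_path ::
  "('k::finite, 'l::finite) path \<Rightarrow> ('r::{comm_ring, comm_monoid_mult}, 'k, 'l) kp"
  is path_term .

lift_definition kp_ghost ::
  "('k::finite, 'l::finite) path \<Rightarrow> ('r::{comm_ring, comm_monoid_mult}, 'k, 'l) kp"
  is ghost_term .

abbreviation kp_vertex ::
  "int ^ 'k \<Rightarrow> ('r::{comm_ring, comm_monoid_mult}, 'k::finite, 'l::finite) kp" where
  "kp_vertex v \<equiv> kp_path (idpath v)"

lemma module_kp_scale: "module (kp_scale :: 'r::comm_ring_1 \<Rightarrow> ('r, 'k::finite, 'l::finite) kp \<Rightarrow> _)"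
proof
  fix a b :: 'r and x y :: "('r, 'k, 'l) kp"
  show "kp_scale a (x + y) = kp_scale a x + kp_scale a y" by transfer (rule alg_eq.scale_add)
  show "kp_scale (a + b) x = kp_scale a x + kp_scale b x" by transfer (rule alg_eq.add_scale)
  show "kp_scale a (kp_scale b x) = kp_scale (a * b) x" by transfer (rule alg_eq.scale_scale)
  show "kp_scale 1 x = x" by transfer (rule alg_eq.scale_one)
qed

lemma KP4_sum:
  fixes v n :: "int ^ 'k::finite"
  assumes "n \<in> Nk - {0}"
  shows "kp_vertex v = (\<Sum>\<alpha>\<in>paths_from v n.
    kp_path \<alpha> * kp_ghost \<alpha> :: ('r::{comm_ring, comm_monoid_mult}, 'k, 'l::finite) kp)"
proof -
  obtain xs :: "('k, 'l) path list" where xs: "set xs = paths_from v n" "distinct xs"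
    using finite_distinct_list[OF finite_paths_from] by blast
  have *: "abs_kp (Sum_list (map (\<lambda>\<alpha>. Mul (path_term \<alpha>) (ghost_term \<alpha>)) ys))
      = sum_list (map (\<lambda>\<alpha>. kp_path \<alpha> * kp_ghost \<alpha> :: ('r, 'k, 'l) kp) ys)" for ys
    by (induction ys)
      (simp_all add: zero_kp_def plus_kp.abs_eq[symmetric] times_kp.abs_eq[symmetric]
        kp_path_def kp_ghost_def)
  have "kp_vertex v = (abs_kp (vertex_term v) :: ('r, 'k, 'l) kp)"
    by (simp add: kp_path_def)
  also have "\<dots> = abs_kp (Sum_list (map (\<lambda>\<alpha>. Mul (path_term \<alpha>) (ghost_term \<alpha>)) xs))"
    by (subst kp.abs_eq_iff) (rule alg_eq.rel, rule kp_rel.KP4[OF assms xs(2,1)])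
  also have "\<dots> = (\<Sum>\<alpha>\<leftarrow>xs. kp_path \<alpha> * kp_ghost \<alpha>)"
    by (rule *)
  finally show ?thesis
    using xs by (simp add: sum_list_distinct_conv_sum_set)
qed


section \<open>Bases\<close>

text \<open>
  The family \<open>b i\<close>, \<open>i \<in> I\<close>, is a basis of the module. Over a nonzero ring this is equivalent to the
  library's notions, see \<open>basis_family_iff\<close>.
\<close>

definition basis_family ::
  "('r::{comm_ring, comm_monoid_mult} \<Rightarrow> 'm \<Rightarrow> 'm::ab_group_add) \<Rightarrow> ('i \<Rightarrow> 'm) \<Rightarrow> 'i set \<Rightarrow> bool"
where
  "basis_family sc b I \<longleftrightarrow>
    (\<forall>x. \<exists>J c. finite J \<and> J \<subseteq> I \<and> x = (\<Sum>i\<in>J. sc (c i) (b i))) \<and>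
    (\<forall>J c. finite J \<longrightarrow> J \<subseteq> I \<longrightarrow> (\<Sum>i\<in>J. sc (c i) (b i)) = 0 \<longrightarrow> (\<forall>i\<in>J. c i = 0))"

lemma (in module) basis_family_iff:
  "basis_family scale b I \<longleftrightarrow> inj_on b I \<and> independent (b ` I) \<and> span (b ` I) = UNIV"
proof
  assume basis: "basis_family scale b I"
  have ind: "c i = 0" if "finite J" "J \<subseteq> I" "(\<Sum>i\<in>J. scale (c i) (b i)) = 0" "i \<in> J" for J c i
    using basis that unfolding basis_family_def by blast
  have inj: "inj_on b I"
  proof (rule inj_onI, rule ccontr)
    fix i j assume ij: "i \<in> I" "j \<in> I" "b i = b j" "i \<noteq> j"
    have "(if i = i then 1 else - 1 :: 'a) = 0"
      by (rule ind[of "{i, j}" "\<lambda>x. if x = i then 1 else - 1" i]) (use ij in auto)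
    then show False by simp
  qed
  have "independent (b ` I)"
    unfolding independent_explicit_module
  proof (intro allI impI)
    fix t u v
    assume *: "finite t" "t \<subseteq> b ` I" "(\<Sum>v\<in>t. scale (u v) v) = 0" "v \<in> t"
    obtain J where J: "J \<subseteq> I" "t = b ` J" "inj_on b J"
      using *(2) by (auto simp: subset_image_inj)
    then obtain j where "j \<in> J" "v = b j" using *(4) by auto
    moreover have "u (b j) = 0"
      by (rule ind[of J "\<lambda>j. u (b j)" j])
        (use J * \<open>j \<in> J\<close> in \<open>auto simp: sum.reindex finite_image_iff\<close>)
    ultimately show "u v = 0" by simp
  qed
  moreover have "x \<in> span (b ` I)" for x
  proof -
    obtain J c where "J \<subseteq> I" "x = (\<Sum>i\<in>J. scale (c i) (b i))"
      using basis unfolding basis_family_def by blast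
    moreover have "scale (c i) (b i) \<in> span (b ` I)" if "i \<in> J" for i
      using that \<open>J \<subseteq> I\<close> by (intro span_scale span_base) blast
    ultimately show ?thesis
      by (simp add: span_sum)
  qed
  ultimately show "inj_on b I \<and> independent (b ` I) \<and> span (b ` I) = UNIV"
    using inj by auto
next
  assume *: "inj_on b I \<and> independent (b ` I) \<and> span (b ` I) = UNIV"
  have "\<exists>J c. finite J \<and> J \<subseteq> I \<and> x = (\<Sum>i\<in>J. scale (c i) (b i))" for x
  proof -
    have "x \<in> span (b ` I)" using * by simp
    then obtain t r where t: "finite t" "t \<subseteq> b ` I" "x = (\<Sum>a\<in>t. scale (r a) a)"
      unfolding span_explicit by blast
    obtain J where J: "J \<subseteq> I" "t = b ` J" "inj_on b J"
      using t(2) by (auto simp: subset_image_inj)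
    have "finite J" "x = (\<Sum>i\<in>J. scale (r (b i)) (b i))"
      using t J by (auto simp: sum.reindex finite_image_iff)
    then show ?thesis using J by (intro exI[of _ J] exI[of _ "\<lambda>i. r (b i)"]) auto
  qed
  moreover have "c i = 0"
    if J: "finite J" "J \<subseteq> I" "(\<Sum>i\<in>J. scale (c i) (b i)) = 0" "i \<in> J" for J c i
  proof -
    have inj: "inj_on b J" using * J inj_on_subset by blast
    have "(\<Sum>v\<in>b ` J. scale (c (the_inv_into J b v)) v) = 0"
      using J inj by (simp add: sum.reindex the_inv_into_f_f)
    then have "c (the_inv_into J b (b i)) = 0"
      using J * independent_explicit_module[of "b ` I"]
      by (meson finite_imageI image_mono imageI)
    then show ?thesis using inj J by (simp add: the_inv_into_f_f)
  qed
  ultimately show "basis_family scale b I"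
    unfolding basis_family_def by blast
qed


section \<open>Pairs of paths and the index set of the basis\<close>

definition A_hat :: "(('k::finite, 'l::finite) path \<times> ('k, 'l) path) set" where
  "A_hat = {(\<alpha>, \<mu>). \<alpha> \<in> nonzero_paths \<and> \<mu> \<in> nonzero_paths \<and> src \<alpha> = src \<mu>}"

abbreviation extend :: "('k::finite, 'l::finite) path \<Rightarrow> int ^ 'k \<Rightarrow> ('k, 'l) path" where
  "extend \<mu> n \<equiv> \<mu> \<cdot> onepath (src \<mu>) n"

definition A_set :: "(('k::finite, 'l::finite) path \<times> ('k, 'l) path) set" where
  "A_set = {(\<alpha>, \<mu>) \<in> A_hat. \<not> (\<exists>n \<in> Nk - {0}. \<exists>\<alpha>' \<mu>'. \<alpha> = extend \<alpha>' n \<and> \<mu> = extend \<mu>' n)}"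

definition A_sim ::
  "((('k::finite, 'l::finite) path \<times> ('k, 'l) path) \<times> (('k, 'l) path \<times> ('k, 'l) path)) set" where
  "A_sim = {((\<alpha>, \<mu>), (\<alpha>', \<mu>')). (\<alpha>, \<mu>) \<in> A_set \<and> (\<alpha>', \<mu>') \<in> A_set \<and>
    (\<exists>m \<in> Nk - {0}. \<exists>n \<in> Nk - {0}. extend \<alpha> m = extend \<alpha>' n \<and> extend \<mu> m = extend \<mu>' n)}"

text \<open>One representative from each equivalence class of \<open>A_sim\<close>.\<close>

definition is_transversal :: "(('k::finite, 'l::finite) path \<times> ('k, 'l) path) set \<Rightarrow> bool" where
  "is_transversal T \<longleftrightarrow> T \<subseteq> A_set \<and> (\<forall>C \<in> A_set // A_sim. \<exists>!x. x \<in> T \<inter> C)"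

datatype ('k::finite, 'l::finite) basis_index =
    Vertex_index "int ^ 'k"
  | Path_index "('k, 'l) path"
  | Ghost_index "('k, 'l) path"
  | Pair_index "('k, 'l) path" "('k, 'l) path"

definition basis_indices ::
  "(('k::finite, 'l::finite) path \<times> ('k, 'l) path) set \<Rightarrow> ('k, 'l) basis_index set" where
  "basis_indices T = range Vertex_index \<union> Path_index ` nonzero_paths \<union> Ghost_index ` nonzero_paths
     \<union> {Pair_index \<alpha> \<mu> | \<alpha> \<mu>. (\<alpha>, \<mu>) \<in> T}"

fun basis_element ::
  "('k::finite, 'l::finite) basis_index \<Rightarrow> ('r::{comm_ring, comm_monoid_mult}, 'k, 'l) kp" where
  "basis_element (Vertex_index v) = kp_vertex v"
| "basis_element (Path_index \<alpha>) = kp_path \<alpha>"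
| "basis_element (Ghost_index \<alpha>) = kp_ghost \<alpha>"
| "basis_element (Pair_index \<alpha> \<mu>) = kp_path \<alpha> * kp_ghost \<mu>"

end

theory Submission
  imports Defs "HOL-Library.Stream"
begin

text \<open>
  In a product \<open>\<alpha>\<mu>\<^sup>*\<close> with \<open>src \<alpha> = src \<mu>\<close> only the two ranges and the two label words matter, not
  the position of the common source: for two possible sources \<open>w, w'\<close>, expanding both products
  by (KP4) down to \<open>w \<and> w'\<close> gives the same sum (\<open>path_ghost_eq_if_same_labels\<close>). Hence, for fixed
  ranges \<open>v, v'\<close>, the span of these products is the direct limit, over decreasing sizes
  \<open>t \<le> vsize (v \<and> v')\<close> of the source, of the free modules on pairs of words \<open>(p, q)\<close> of lengths
  \<open>vsize v - t\<close> and \<open>vsize v' - t\<close>, with transition maps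
  \<open>(p, q) \<mapsto> (\<Sum>a. (p @ [a], q @ [a]))\<close>. Exchanging \<open>(p @ [1], q @ [1])\<close> for \<open>(p, q)\<close> at each level, one
  finds a basis: all pairs of the top level \<open>t = vsize (v \<and> v')\<close>, and from each lower level the pairs
  of words that do not both end in \<open>1\<close>. The pairs with an empty word belong to the top level; they are
  the vertices, the paths and the ghost paths. The other pairs in this basis are the classes of
  \<open>A_sim\<close>, since on \<open>A_set\<close> this relation means equality of ranges and label words
  (\<open>A_sim_imp_same_labels\<close>, \<open>A_sim_if_same_labels\<close>).

  That the basis spans follows from two facts: the products \<open>\<alpha>\<mu>\<^sup>*\<close> span the algebra, because
  multiplication by a generator from the left preserves their span (\<open>path_ghost_products_span\<close>), and
  each of them reduces to the basis by induction on the length of \<open>\<alpha>\<close> (\<open>path_ghost_in_basis_span\<close>).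

  For independence the algebra acts on functions of an object and an infinite sequence of labels, a
  path prepending its labels and a ghost path removing them. In a vanishing linear combination take a
  basis element \<open>\<alpha>\<mu>\<^sup>*\<close> with nonzero coefficient whose source has maximal size, and consider the matrix
  entry of the combination at \<open>(rng \<alpha>, labels \<alpha> @- sconst 1)\<close>, \<open>(rng \<mu>, labels \<mu> @- sconst 1)\<close>. Another
  basis element with a nonzero entry there cannot have a source of the same size, as then it has the same
  words; nor one of smaller size, as then it is below the top level and both its words end in \<open>1\<close>.
  So the entry is the chosen coefficient, which therefore vanishes.
\<close>

section \<open>Sizes of degrees and construction of paths\<close>

lemma vsize_add: "vsize (a + b) = vsize a + vsize b"
  by (simp add: vsize_def sum.distrib)

lemma vsize_diff: "vsize (a - b) = vsize a - vsize b"
  by (simp add: vsize_def sum_subtractf)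

lemma vsize_0 [simp]: "vsize 0 = 0"
  by (simp add: vsize_def)

lemma vsize_mono: "a \<le> b \<Longrightarrow> vsize a \<le> vsize b"
  by (auto simp: vsize_def less_eq_vec_def intro: sum_mono)

lemma vsize_axis [simp]: "vsize (axis i 1) = 1"
  by (simp add: vsize_def axis_def)

lemma ex_coordinate_less: "vsize a < vsize b \<Longrightarrow> \<exists>i. a $ i < b $ i"
  by (metis less_eq_vec_def linorder_not_less vsize_mono)

lemma eq_if_vsize_eq: "a \<le> b \<Longrightarrow> vsize a = vsize b \<Longrightarrow> a = b"
proof (rule ccontr)
  assume "a \<le> b" "vsize a = vsize b" "a \<noteq> b"
  then obtain i where "a $ i \<noteq> b $ i" by (auto simp: vec_eq_iff)
  have "(\<Sum>i\<in>UNIV. a $ i) < (\<Sum>i\<in>UNIV. b $ i)"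
    using \<open>a \<le> b\<close> \<open>a $ i \<noteq> b $ i\<close>
    by (intro sum_strict_mono_ex1) (auto simp: less_eq_vec_def order.strict_iff_order)
  then show False using \<open>vsize a = vsize b\<close> by (simp add: vsize_def)
qed

lemma axis_in_Nk: "axis i 1 \<in> Nk - {0}"
  by (auto simp: Nk_def less_eq_vec_def axis_def vec_eq_iff)

text \<open>
  The path with given range, source and labels; where there is none, the identity at the intended range
  is a dummy value.
\<close>

lift_definition mk_path :: "int ^ 'k \<Rightarrow> int ^ 'k \<Rightarrow> nat list \<Rightarrow> ('k::finite, 'l::finite) path"
  is "\<lambda>v w p. if w \<le> v \<and> int (length p) = vsize (v - w) \<and> set p \<subseteq> {1..CARD('l)}
    then (v, w, p) else (v, v, [])"
  by (auto simp: vsize_def)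

lemma mk_path_sel:
  assumes "w \<le> v" "int (length p) = vsize (v - w)" "set p \<subseteq> {1..CARD('l)}"
  shows "rng (mk_path v w p :: ('k::finite, 'l::finite) path) = v"
    "src (mk_path v w p :: ('k::finite, 'l::finite) path) = w"
    "labels (mk_path v w p :: ('k::finite, 'l::finite) path) = p"
  using assms by (transfer; auto)+

lemma src_le_rng: "src \<alpha> \<le> rng \<alpha>"
  by transfer auto

lemma length_labels_eq: "int (length (labels \<alpha>)) = vsize (rng \<alpha>) - vsize (src \<alpha>)"
  using length_labels[of \<alpha>] by (simp add: deg_def vsize_diff)

lemma idpath_sel [simp]:
  "rng (idpath v) = v" "src (idpath v) = v" "labels (idpath v) = []" "deg (idpath v) = 0"
  unfolding deg_def by (transfer; simp)+

lemma deg_eq_0_iff: "deg \<alpha> = 0 \<longleftrightarrow> labels \<alpha> = []"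
proof
  assume "labels \<alpha> = []"
  then have "vsize (src \<alpha>) = vsize (rng \<alpha>)" using length_labels_eq[of \<alpha>] by simp
  then show "deg \<alpha> = 0" using eq_if_vsize_eq[OF src_le_rng, of \<alpha>] by (simp add: deg_def)
qed (use length_labels[of \<alpha>] in auto)

lemma eq_idpath: "deg \<alpha> = 0 \<Longrightarrow> \<alpha> = idpath (rng \<alpha>)"
  by (rule path_eqI) (auto simp: deg_eq_0_iff, simp add: deg_def flip: deg_eq_0_iff)

lemma nonzero_paths_iff: "\<alpha> \<in> nonzero_paths \<longleftrightarrow> labels \<alpha> \<noteq> []"
  by (simp add: nonzero_paths_def deg_eq_0_iff)

lemma onepath_sel:
  "n \<in> Nk \<Longrightarrow> src (onepath v n) = v - n"
  "n \<in> Nk \<Longrightarrow> labels (onepath v n) = replicate (nat (vsize n)) 1"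
  unfolding Nk_def by (transfer; simp)+

lemma vsize_pos: "n \<in> Nk - {0} \<Longrightarrow> 0 < vsize n"
  using vsize_mono[of 0 n] eq_if_vsize_eq[of 0 n] by (force simp: Nk_def)

lemma pcomp_idpath [simp]:
  "v = src \<alpha> \<Longrightarrow> \<alpha> \<cdot> idpath v = \<alpha>" "v = rng \<alpha> \<Longrightarrow> idpath v \<cdot> \<alpha> = \<alpha>"
  by (rule path_eqI; simp add: rng_pcomp src_pcomp labels_pcomp)+

lemma extend_sel:
  assumes "n \<in> Nk" "w = src \<alpha>"
  shows "rng (\<alpha> \<cdot> onepath w n) = rng \<alpha>" "src (\<alpha> \<cdot> onepath w n) = src \<alpha> - n"
    "labels (\<alpha> \<cdot> onepath w n) = labels \<alpha> @ replicate (nat (vsize n)) 1"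
  using assms by (simp_all add: rng_pcomp src_pcomp labels_pcomp rng_onepath onepath_sel)

text \<open>
  The labels of a path do not record in which coordinate its edges run, so a path whose last label is
  \<open>1\<close> ends in the edge of label \<open>1\<close> in every coordinate in which its degree is positive.
\<close>

lemma extendE:
  assumes "src \<alpha> + axis i 1 \<le> rng \<alpha>" "labels \<alpha> \<noteq> []" "last (labels \<alpha>) = 1"
  obtains \<alpha>' where "\<alpha> = extend \<alpha>' (axis i 1)"
proof -
  let ?\<beta> = "mk_path (rng \<alpha>) (src \<alpha> + axis i 1) (butlast (labels \<alpha>)) :: ('a, 'b) path"
  have "set (butlast (labels \<alpha>)) \<subseteq> {1..CARD('b)}"
    using set_labels[of \<alpha>] by (auto dest: in_set_butlastD)
  moreover have "int (length (butlast (labels \<alpha>))) = vsize (rng \<alpha> - (src \<alpha> + axis i 1))"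
    using length_labels_eq[of \<alpha>] assms(2) by (cases "labels \<alpha>") (auto simp: vsize_diff vsize_add)
  ultimately have *: "rng ?\<beta> = rng \<alpha>" "src ?\<beta> = src \<alpha> + axis i 1"
    "labels ?\<beta> = butlast (labels \<alpha>)"
    using mk_path_sel assms(1) by metis+
  have "\<alpha> = extend ?\<beta> (axis i 1)"
    using axis_in_Nk[of i] append_butlast_last_id[OF assms(2)] assms(3)
    by (intro path_eqI) (auto simp: extend_sel *)
  then show ?thesis by (rule that)
qed

section \<open>The equivalence relation on pairs\<close>

text \<open>
  If the common source has smaller size than some common lower bound of the ranges, then both degrees are
  positive in a common coordinate. Two last labels \<open>1\<close> would then let a common edge be split off.
\<close>

lemma A_set_last_neq_one:
  assumes "(\<alpha>, \<mu>) \<in> A_set" "u \<le> rng \<alpha>" "u \<le> rng \<mu>" "vsize (src \<alpha>) < vsize u"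
  shows "last (labels \<alpha>) \<noteq> 1 \<or> last (labels \<mu>) \<noteq> 1"
proof (rule ccontr)
  assume last: "\<not> ?thesis"
  have hat: "labels \<alpha> \<noteq> []" "labels \<mu> \<noteq> []" "src \<alpha> = src \<mu>"
    using assms(1) by (auto simp: A_set_def A_hat_def nonzero_paths_iff)
  obtain i where i: "src \<alpha> $ i < u $ i" using ex_coordinate_less assms(4) by blast
  have "src \<beta> + axis i 1 \<le> rng \<beta>" if "src \<beta> = src \<alpha>" "u \<le> rng \<beta>" for \<beta> :: "('a, 'b) path"
    unfolding less_eq_vec_def
  proof
    fix j
    show "(src \<beta> + axis i 1) $ j \<le> rng \<beta> $ j"
      using that i src_le_rng[of \<beta>] by (cases "j = i") (auto simp: less_eq_vec_def axis_def dest: spec[of _ i])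
  qed
  then have "src \<alpha> + axis i 1 \<le> rng \<alpha>" "src \<mu> + axis i 1 \<le> rng \<mu>"
    using assms hat by auto
  then obtain \<alpha>' \<mu>' where "\<alpha> = extend \<alpha>' (axis i 1)" "\<mu> = extend \<mu>' (axis i 1)"
    using extendE last hat by metis
  then show False using assms(1) axis_in_Nk[of i] unfolding A_set_def by blast
qed

lemma A_setI_last:
  assumes "src \<alpha> = src \<mu>" "labels \<alpha> \<noteq> []" "labels \<mu> \<noteq> []" "last (labels \<alpha>) \<noteq> 1"
  shows "(\<alpha>, \<mu>) \<in> A_set"
proof -
  have "\<alpha> \<noteq> extend \<alpha>' n" if "n \<in> Nk - {0}" for n and \<alpha>' :: "('a, 'b) path"
    using that assms(4) vsize_pos[OF that] by (auto simp: extend_sel)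
  then show ?thesis
    using assms by (auto simp: A_set_def A_hat_def nonzero_paths_iff)
qed

text \<open>
  A common factor of arbitrary nonzero degree contains one of degree a unit vector, for which (KP4)
  has only paths with a single label in its sum.
\<close>

lemma not_in_A_setE:
  assumes "(\<alpha>, \<mu>) \<in> A_hat" "(\<alpha>, \<mu>) \<notin> A_set"
  obtains i \<alpha>' \<mu>' where "\<alpha> = extend \<alpha>' (axis i 1)" "\<mu> = extend \<mu>' (axis i 1)"
proof -
  obtain n \<beta> \<gamma> where n: "n \<in> Nk - {0}" and eq: "\<alpha> = extend \<beta> n" "\<mu> = extend \<gamma> n"
    using assms by (auto simp: A_set_def)
  have pos: "0 < vsize n" using n by (rule vsize_pos)
  obtain i where i: "0 < n $ i" using ex_coordinate_less[of 0 n] pos by auto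
  have "\<exists>\<beta>'. \<beta>'' = extend \<beta>' (axis i 1)" if "\<beta>'' = extend \<beta> n" for \<beta> \<beta>'' :: "('a, 'b) path"
  proof -
    have "src \<beta>'' + axis i 1 \<le> rng \<beta>''"
      unfolding that less_eq_vec_def
    proof
      fix j
      have "src \<beta> $ j \<le> rng \<beta> $ j" "0 \<le> n $ j"
        using n src_le_rng[of \<beta>] by (auto simp: Nk_def less_eq_vec_def)
      then show "(src (extend \<beta> n) + axis i 1) $ j \<le> rng (extend \<beta> n) $ j"
        using n i by (auto simp: extend_sel axis_def)
    qed
    moreover have "labels \<beta>'' \<noteq> []" "last (labels \<beta>'') = 1"
      using n pos that by (auto simp: extend_sel)
    ultimately show ?thesis using extendE by metis
  qed
  from this[OF eq(1)] this[OF eq(2)] show ?thesis using that by auto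
qed

lemma A_sim_sym: "(x, y) \<in> A_sim \<Longrightarrow> (y, x) \<in> A_sim"
proof -
  assume "(x, y) \<in> A_sim"
  then obtain \<alpha> \<mu> \<alpha>' \<mu>' m n where "x = (\<alpha>, \<mu>)" "y = (\<alpha>', \<mu>')"
    "(\<alpha>, \<mu>) \<in> A_set" "(\<alpha>', \<mu>') \<in> A_set" "m \<in> Nk - {0}" "n \<in> Nk - {0}"
    "extend \<alpha> m = extend \<alpha>' n" "extend \<mu> m = extend \<mu>' n"
    unfolding A_sim_def by blast
  moreover from this have "extend \<alpha>' n = extend \<alpha> m" "extend \<mu>' n = extend \<mu> m" by simp_all
  ultimately show ?thesis unfolding A_sim_def by blast
qed

text \<open>
  If \<open>\<alpha>\<close> were the longer path, the two equations of \<open>A_sim\<close> would make both \<open>\<alpha>\<close> and \<open>\<mu>\<close> end in \<open>1\<close>,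
  while the source of \<open>\<alpha>'\<close> is a common lower bound of the ranges of larger size than \<open>src \<alpha>\<close>; this
  contradicts \<open>(\<alpha>, \<mu>) \<in> A_set\<close>.
\<close>

lemma A_sim_length_le:
  assumes "((\<alpha>, \<mu>), (\<alpha>', \<mu>')) \<in> A_sim"
  shows "length (labels \<alpha>) \<le> length (labels \<alpha>')"
proof (rule ccontr)
  assume longer: "\<not> ?thesis"
  obtain m n where mn: "m \<in> Nk" "n \<in> Nk"
      and eq: "extend \<alpha> m = extend \<alpha>' n" "extend \<mu> m = extend \<mu>' n"
    and A: "(\<alpha>, \<mu>) \<in> A_set" "(\<alpha>', \<mu>') \<in> A_set"
    using assms by (auto simp: A_sim_def)
  have rng: "rng \<alpha> = rng \<alpha>'" "rng \<mu> = rng \<mu>'"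
    using eq mn by (metis extend_sel(1))+
  have src: "src \<alpha> = src \<mu>" "src \<alpha>' = src \<mu>'"
    using A by (auto simp: A_set_def A_hat_def)
  have less: "vsize (src \<alpha>) < vsize (src \<alpha>')"
    using length_labels_eq[of \<alpha>] length_labels_eq[of \<alpha>'] longer rng by simp
  have last: "last (labels \<beta>) = 1"
    if "extend \<beta> m = extend \<beta>' n" "vsize (src \<beta>) < vsize (src \<beta>')" for \<beta> \<beta>' :: "('a, 'b) path"
  proof -
    have l: "labels \<beta> @ replicate (nat (vsize m)) 1 = labels \<beta>' @ replicate (nat (vsize n)) 1"
      using that(1) mn by (metis extend_sel(3))
    have "rng \<beta> = rng \<beta>'" using that(1) mn by (metis extend_sel(1))
    then have len: "length (labels \<beta>') < length (labels \<beta>)"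
      using length_labels_eq[of \<beta>] length_labels_eq[of \<beta>'] that(2) by simp
    then have "last (labels \<beta>) = labels \<beta> ! (length (labels \<beta>) - 1)"
      by (intro last_conv_nth) auto
    also have "\<dots> = (labels \<beta>' @ replicate (nat (vsize n)) 1) ! (length (labels \<beta>) - 1)"
      unfolding l[symmetric] using len by (intro nth_append_left[symmetric]) auto
    also have "\<dots> = 1"
      using len arg_cong[OF l, of length] by (auto simp: nth_append less_diff_conv2)
    finally show ?thesis .
  qed
  have "last (labels \<alpha>) = 1" "last (labels \<mu>) = 1"
    using last[OF eq(1)] last[OF eq(2)] less src by simp_all
  then show False
    using A_set_last_neq_one[OF A(1), of "src \<alpha>'"] less src rng
      src_le_rng[of \<alpha>'] src_le_rng[of \<mu>'] by simp
qed

lemma A_sim_imp_same_labels: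
  assumes "((\<alpha>, \<mu>), (\<alpha>', \<mu>')) \<in> A_sim"
  shows "rng \<alpha> = rng \<alpha>'" "rng \<mu> = rng \<mu>'" "labels \<alpha> = labels \<alpha>'" "labels \<mu> = labels \<mu>'"
    "src \<alpha> = src \<mu>" "src \<alpha>' = src \<mu>'"
proof -
  obtain m n where mn: "m \<in> Nk" "n \<in> Nk"
      and eq: "extend \<alpha> m = extend \<alpha>' n" "extend \<mu> m = extend \<mu>' n"
    and A: "(\<alpha>, \<mu>) \<in> A_set" "(\<alpha>', \<mu>') \<in> A_set"
    using assms by (auto simp: A_sim_def)
  show rng: "rng \<alpha> = rng \<alpha>'" "rng \<mu> = rng \<mu>'"
    using eq mn by (metis extend_sel(1))+
  show src: "src \<alpha> = src \<mu>" "src \<alpha>' = src \<mu>'"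
    using A by (auto simp: A_set_def A_hat_def)
  have "length (labels \<alpha>) = length (labels \<alpha>')"
    using A_sim_length_le[OF assms] A_sim_length_le[OF A_sim_sym[OF assms]] by simp
  moreover from this have "length (labels \<mu>) = length (labels \<mu>')"
    using length_labels_eq[of \<alpha>] length_labels_eq[of \<alpha>'] length_labels_eq[of \<mu>]
      length_labels_eq[of \<mu>'] rng src by simp
  ultimately show "labels \<alpha> = labels \<alpha>'" "labels \<mu> = labels \<mu>'"
    using arg_cong[OF eq(1), of labels] arg_cong[OF eq(2), of labels] mn by (auto simp: extend_sel)
qed

lemma A_sim_if_same_labels:
  assumes A: "(\<alpha>, \<mu>) \<in> A_set" "(\<alpha>', \<mu>') \<in> A_set"
    and eq: "rng \<alpha> = rng \<alpha>'" "rng \<mu> = rng \<mu>'" "labels \<alpha> = labels \<alpha>'" "labels \<mu> = labels \<mu>'"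
  shows "((\<alpha>, \<mu>), (\<alpha>', \<mu>')) \<in> A_sim"
proof -
  \<comment> \<open>One below the minimum, so that both extensions have nonzero degree even if the sources agree.\<close>
  define u where "u = (\<chi> i. min (src \<alpha> $ i) (src \<alpha>' $ i) - 1)"
  let ?m = "src \<alpha> - u" and ?n = "src \<alpha>' - u"
  have src: "src \<alpha> = src \<mu>" "src \<alpha>' = src \<mu>'"
    using A by (auto simp: A_set_def A_hat_def)
  have N: "?m \<in> Nk - {0}" "?n \<in> Nk - {0}"
    by (auto simp: u_def Nk_def less_eq_vec_def vec_eq_iff min_def)
  have "vsize ?m = vsize ?n"
    using length_labels_eq[of \<alpha>] length_labels_eq[of \<alpha>'] eq by (simp add: vsize_diff)
  moreover have "?m \<in> Nk" "?n \<in> Nk" using N by auto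
  ultimately have "extend \<alpha> ?m = extend \<alpha>' ?n"
    by (intro path_eqI) (simp_all only: extend_sel eq, simp)
  moreover have "extend \<mu> (src \<mu> - u) = extend \<mu>' (src \<mu>' - u)"
    using \<open>?m \<in> Nk\<close> \<open>?n \<in> Nk\<close> \<open>vsize ?m = vsize ?n\<close> unfolding src
    by (intro path_eqI) (simp_all only: extend_sel eq, simp)
  ultimately have "extend \<alpha> ?m = extend \<alpha>' ?n" "extend \<mu> ?m = extend \<mu>' ?n"
    by (simp_all only: src)
  then show ?thesis using A N unfolding A_sim_def by blast
qed

lemma transversal_representative:
  assumes "is_transversal T" "x \<in> A_set"
  obtains y where "y \<in> T" "(x, y) \<in> A_sim"
proof -
  have "\<exists>!z. z \<in> T \<inter> A_sim `` {x}"
    by (rule bspec[OF conjunct2[OF assms(1)[unfolded is_transversal_def]] quotientI[OF assms(2)]])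
  then have "\<exists>z. z \<in> T \<inter> A_sim `` {x}" by (rule ex1_implies_ex)
  then show ?thesis using that by auto
qed

lemma transversal_unique:
  assumes "is_transversal T" "x \<in> T" "y \<in> T" "(x, y) \<in> A_sim"
  shows "x = y"
proof -
  have "x \<in> A_set" using assms by (auto simp: is_transversal_def)
  then have "(x, x) \<in> A_sim"
    using A_sim_if_same_labels by (cases x) auto
  then have "x \<in> T \<inter> A_sim `` {x}" "y \<in> T \<inter> A_sim `` {x}"
    using assms by auto
  moreover have "\<exists>!z. z \<in> T \<inter> A_sim `` {x}"
    by (rule bspec[OF conjunct2[OF assms(1)[unfolded is_transversal_def]] quotientI[OF \<open>x \<in> A_set\<close>]])
  ultimately show ?thesis by blast
qed

section \<open>Relations in the Kumjian-Pask algebra\<close>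

lemma kp_vertex_mult:
  "kp_vertex v * kp_vertex w =
    (if v = w then kp_vertex v else 0 :: ('r::{comm_ring, comm_monoid_mult}, 'k::finite, 'l::finite) kp)"
proof (cases "v = w")
  case True
  have "kp_vertex w * kp_vertex w = (kp_vertex w :: ('r, 'k, 'l) kp)"
    by transfer (rule alg_eq.rel, rule KP1_idem)
  then show ?thesis using True by simp
next
  case False
  then have "kp_vertex v * kp_vertex w = (0 :: ('r, 'k, 'l) kp)"
    by transfer (rule alg_eq.rel, rule KP1_orth)
  then show ?thesis using False by simp
qed

lemma kp_ghost_deg_0: "deg \<alpha> = 0 \<Longrightarrow> kp_ghost \<alpha> = kp_path \<alpha>"
  by transfer (simp add: ghost_term_def path_term_def alg_eq.refl)

lemma kp_ghost_idpath [simp]: "kp_ghost (idpath v) = kp_vertex v"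
  by (rule kp_ghost_deg_0) simp

lemma path_deg_cases:
  obtains v where "\<alpha> = idpath v" | "\<alpha> \<in> nonzero_paths"
  using eq_idpath[of \<alpha>] by (auto simp: nonzero_paths_def)

lemma rng_mult_path: "kp_vertex (rng \<alpha>) * kp_path \<alpha> = kp_path \<alpha>"
proof (cases \<alpha> rule: path_deg_cases)
  case 2
  then show ?thesis by transfer (rule alg_eq.rel, rule KP2_rng)
qed (simp add: kp_vertex_mult)

lemma path_mult_src: "kp_path \<alpha> * kp_vertex (src \<alpha>) = kp_path \<alpha>"
proof (cases \<alpha> rule: path_deg_cases)
  case 2
  then show ?thesis by transfer (rule alg_eq.rel, rule KP2_src)
qed (simp add: kp_vertex_mult)

lemma path_mult_vertex: "v = src \<alpha> \<Longrightarrow> kp_path \<alpha> * kp_vertex v = kp_path \<alpha>"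
  by (simp add: path_mult_src)

lemma src_mult_ghost: "kp_vertex (src \<alpha>) * kp_ghost \<alpha> = kp_ghost \<alpha>"
proof (cases \<alpha> rule: path_deg_cases)
  case 2
  then show ?thesis by transfer (rule alg_eq.rel, rule KP2_ghost_src)
qed (simp add: kp_vertex_mult)

lemma ghost_mult_rng: "kp_ghost \<alpha> * kp_vertex (rng \<alpha>) = kp_ghost \<alpha>"
proof (cases \<alpha> rule: path_deg_cases)
  case 2
  then show ?thesis by transfer (rule alg_eq.rel, rule KP2_ghost_rng)
qed (simp add: kp_vertex_mult)

lemma path_mult_path:
  assumes "src \<alpha> = rng \<beta>"
  shows "kp_path \<alpha> * kp_path \<beta> = kp_path (\<alpha> \<cdot> \<beta>)"
proof (cases \<alpha> rule: path_deg_cases)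
  case 1
  then show ?thesis using rng_mult_path[of \<beta>] assms by simp
next
  case nz: 2
  show ?thesis
  proof (cases \<beta> rule: path_deg_cases)
    case 1
    then show ?thesis using path_mult_src[of \<alpha>] assms by simp
  next
    case 2
    with nz assms show ?thesis by transfer (rule alg_eq.rel, rule KP2_comp, auto)
  qed
qed

lemma ghost_mult_ghost:
  assumes "src \<alpha> = rng \<beta>"
  shows "kp_ghost \<beta> * kp_ghost \<alpha> = kp_ghost (\<alpha> \<cdot> \<beta>)"
proof (cases \<alpha> rule: path_deg_cases)
  case 1
  then show ?thesis using ghost_mult_rng[of \<beta>] assms by simp
next
  case nz: 2
  show ?thesis
  proof (cases \<beta> rule: path_deg_cases)
    case 1
    then show ?thesis using src_mult_ghost[of \<alpha>] assms by simp
  next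
    case 2
    with nz assms show ?thesis by transfer (rule alg_eq.rel, rule KP2_ghost_comp, auto)
  qed
qed

lemma path_mult_path_zero:
  assumes "src \<alpha> \<noteq> rng \<beta>"
  shows "kp_path \<alpha> * kp_path \<beta> = 0"
proof -
  have "kp_path \<alpha> * kp_path \<beta> = kp_path \<alpha> * (kp_vertex (src \<alpha>) * kp_vertex (rng \<beta>)) * kp_path \<beta>"
    by (metis mult.assoc path_mult_src rng_mult_path)
  then show ?thesis using assms by (simp add: kp_vertex_mult)
qed

lemma ghost_mult_path_zero:
  assumes "rng \<alpha> \<noteq> rng \<beta>"
  shows "kp_ghost \<alpha> * kp_path \<beta> = 0"
proof -
  have "kp_ghost \<alpha> * kp_path \<beta> = kp_ghost \<alpha> * (kp_vertex (rng \<alpha>) * kp_vertex (rng \<beta>)) * kp_path \<beta>"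
    by (metis mult.assoc ghost_mult_rng rng_mult_path)
  then show ?thesis using assms by (simp add: kp_vertex_mult)
qed

lemma ghost_mult_path:
  assumes "deg \<alpha> = deg \<beta>"
  shows "kp_ghost \<alpha> * kp_path \<beta> = (if \<alpha> = \<beta> then kp_vertex (src \<alpha>)
    else 0 :: ('r::{comm_ring, comm_monoid_mult}, 'k::finite, 'l::finite) kp)"
proof (cases "deg \<alpha> = 0")
  case True
  then obtain v w where "\<alpha> = idpath v" "\<beta> = idpath w" using eq_idpath assms by metis
  moreover have "idpath v = (idpath w :: ('k, 'l) path) \<Longrightarrow> v = w" by (metis idpath_sel(1))
  ultimately show ?thesis by (auto simp: kp_vertex_mult)
next
  case False
  have "alg_eq kp_rel (Mul (ghost_term \<alpha>) (path_term \<beta>))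
    (if \<alpha> = \<beta> then vertex_term (src \<alpha>) else Zero :: ('r, ('k, 'l) generator) alg_term)"
    using False assms by (intro alg_eq.rel KP3) (auto simp: nonzero_paths_def)
  then have "kp_ghost \<alpha> * kp_path \<beta> =
    (abs_kp (if \<alpha> = \<beta> then vertex_term (src \<alpha>) else Zero) :: ('r, 'k, 'l) kp)"
    by (simp add: kp_ghost_def kp_path_def times_kp.abs_eq kp.abs_eq_iff)
  then show ?thesis
    by (simp add: kp_path_def zero_kp_def)
qed

lemma paths_from_0: "paths_from v 0 = {idpath v}"
  using eq_idpath by (auto simp: paths_from_def)

lemma vertex_expand:
  "n \<in> Nk \<Longrightarrow> kp_vertex v = (\<Sum>\<nu>\<in>paths_from v n. kp_path \<nu> * kp_ghost \<nu>)"
  using KP4_sum[of n v] by (cases "n = 0") (auto simp: paths_from_0 kp_vertex_mult)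

text \<open>
  Inserting (KP4) at the common source of a path and a ghost path.
\<close>

lemma path_ghost_expand:
  assumes "src \<alpha> = src \<mu>" "n \<in> Nk"
  shows "kp_path \<alpha> * kp_ghost \<mu> =
    (\<Sum>\<nu>\<in>paths_from (src \<alpha>) n. kp_path (\<alpha> \<cdot> \<nu>) * kp_ghost (\<mu> \<cdot> \<nu>))"
proof -
  have "kp_path \<alpha> * kp_ghost \<mu> = kp_path \<alpha> * kp_vertex (src \<alpha>) * kp_ghost \<mu>"
    by (simp add: path_mult_src)
  also have "\<dots> = (\<Sum>\<nu>\<in>paths_from (src \<alpha>) n. (kp_path \<alpha> * kp_path \<nu>) * (kp_ghost \<nu> * kp_ghost \<mu>))"
    by (subst vertex_expand[OF assms(2)])
      (simp add: sum_distrib_left sum_distrib_right mult.assoc)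
  also have "\<dots> = (\<Sum>\<nu>\<in>paths_from (src \<alpha>) n. kp_path (\<alpha> \<cdot> \<nu>) * kp_ghost (\<mu> \<cdot> \<nu>))"
    using assms(1) by (intro sum.cong) (auto simp: paths_from_def path_mult_path ghost_mult_ghost)
  finally show ?thesis .
qed

text \<open>
  Both products are expanded to the componentwise minimum of the two sources. The sources have the same
  size, as the paths have the same ranges and lengths, so the two sums run over the same label words.
\<close>

lemma path_ghost_eq_if_same_labels:
  assumes "rng \<alpha> = rng \<alpha>'" "rng \<mu> = rng \<mu>'" "labels \<alpha> = labels \<alpha>'" "labels \<mu> = labels \<mu>'"
    "src \<alpha> = src \<mu>" "src \<alpha>' = src \<mu>'"
  shows "kp_path \<alpha> * kp_ghost \<mu> = kp_path \<alpha>' * kp_ghost \<mu>'"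
proof -
  define u where "u = (\<chi> i. min (src \<alpha> $ i) (src \<alpha>' $ i))"
  define m n where "m = src \<alpha> - u" and "n = src \<alpha>' - u"
  have mn: "m \<in> Nk" "n \<in> Nk"
    by (auto simp: m_def n_def u_def Nk_def less_eq_vec_def)
  have size: "vsize m = vsize n"
    using length_labels_eq[of \<alpha>] length_labels_eq[of \<alpha>'] assms
    by (simp add: m_def n_def vsize_diff)
  \<comment> \<open>Keeping the labels matches the paths from one source with those from the other.\<close>
  have *: "(mk_path w (w - d) (labels \<nu>) :: ('a, 'b) path) \<in> paths_from w d"
      "src (mk_path w (w - d) (labels \<nu>) :: ('a, 'b) path) = w - d"
      "rng (mk_path w (w - d) (labels \<nu>) :: ('a, 'b) path) = w"
      "labels (mk_path w (w - d) (labels \<nu>) :: ('a, 'b) path) = labels \<nu>"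
    if "d \<in> Nk" "vsize d = vsize d'" "\<nu> \<in> paths_from w' d'" for w w' d d' and \<nu> :: "('a, 'b) path"
  proof -
    have "w - d \<le> w" using that(1) by (simp add: Nk_def less_eq_vec_def)
    moreover have "int (length (labels \<nu>)) = vsize (w - (w - d))"
      using that length_labels[of \<nu>] by (simp add: paths_from_def)
    ultimately show "src (mk_path w (w - d) (labels \<nu>) :: ('a, 'b) path) = w - d"
      "rng (mk_path w (w - d) (labels \<nu>) :: ('a, 'b) path) = w"
      "labels (mk_path w (w - d) (labels \<nu>) :: ('a, 'b) path) = labels \<nu>"
      using mk_path_sel set_labels by blast+
    then show "(mk_path w (w - d) (labels \<nu>) :: ('a, 'b) path) \<in> paths_from w d"
      by (simp add: paths_from_def deg_def)
  qed
  have inv: "mk_path w (w - d) (labels \<nu>) = \<nu>" if "d \<in> Nk" "\<nu> \<in> paths_from w d"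
    for w d and \<nu> :: "('a, 'b) path"
    using that *[OF that(1) HOL.refl that(2)] by (intro path_eqI) (auto simp: paths_from_def deg_def)
  have "kp_path \<alpha> * kp_ghost \<mu> = (\<Sum>\<nu>\<in>paths_from (src \<alpha>) m. kp_path (\<alpha> \<cdot> \<nu>) * kp_ghost (\<mu> \<cdot> \<nu>))"
    using assms(5) mn(1) by (rule path_ghost_expand)
  also have "\<dots> = (\<Sum>\<nu>\<in>paths_from (src \<alpha>') n. kp_path (\<alpha>' \<cdot> \<nu>) * kp_ghost (\<mu>' \<cdot> \<nu>))"
  proof (rule sum.reindex_bij_witness[where
        i = "\<lambda>\<nu>. mk_path (src \<alpha>) (src \<alpha> - m) (labels \<nu>)" and
        j = "\<lambda>\<nu>. mk_path (src \<alpha>') (src \<alpha>' - n) (labels \<nu>)"])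
    fix \<nu> :: "('a, 'b) path" assume \<nu>: "\<nu> \<in> paths_from (src \<alpha>) m"
    note sel = *[OF mn(2) size[symmetric] \<nu>, of "src \<alpha>'"]
    show "mk_path (src \<alpha>) (src \<alpha> - m) (labels (mk_path (src \<alpha>') (src \<alpha>' - n) (labels \<nu>) :: ('a, 'b) path)) = \<nu>"
      unfolding sel by (rule inv[OF mn(1) \<nu>])
    show "(mk_path (src \<alpha>') (src \<alpha>' - n) (labels \<nu>) :: ('a, 'b) path) \<in> paths_from (src \<alpha>') n" by (rule sel)
    define \<nu>' :: "('a, 'b) path" where "\<nu>' = mk_path (src \<alpha>') (src \<alpha>' - n) (labels \<nu>)"
    have "rng \<nu>' = src \<alpha>'" "src \<nu>' = src \<nu>" "labels \<nu>' = labels \<nu>" "rng \<nu> = src \<alpha>"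
      using sel \<nu> by (auto simp: \<nu>'_def paths_from_def deg_def m_def n_def)
    then have "\<alpha>' \<cdot> \<nu>' = \<alpha> \<cdot> \<nu>" "\<mu>' \<cdot> \<nu>' = \<mu> \<cdot> \<nu>"
      using assms by (auto intro!: path_eqI simp: rng_pcomp src_pcomp labels_pcomp)
    then show "kp_path (\<alpha>' \<cdot> mk_path (src \<alpha>') (src \<alpha>' - n) (labels \<nu>))
        * kp_ghost (\<mu>' \<cdot> mk_path (src \<alpha>') (src \<alpha>' - n) (labels \<nu>))
      = kp_path (\<alpha> \<cdot> \<nu>) * kp_ghost (\<mu> \<cdot> \<nu>)"
      by (simp add: \<nu>'_def)
  next
    fix \<nu> :: "('a, 'b) path" assume \<nu>: "\<nu> \<in> paths_from (src \<alpha>') n"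
    note sel = *[OF mn(1) size \<nu>, of "src \<alpha>"]
    show "mk_path (src \<alpha>') (src \<alpha>' - n) (labels (mk_path (src \<alpha>) (src \<alpha> - m) (labels \<nu>) :: ('a, 'b) path)) = \<nu>"
      unfolding sel by (rule inv[OF mn(2) \<nu>])
    show "(mk_path (src \<alpha>) (src \<alpha> - m) (labels \<nu>) :: ('a, 'b) path) \<in> paths_from (src \<alpha>) m" by (rule sel)
  qed
  also have "\<dots> = kp_path \<alpha>' * kp_ghost \<mu>'"
    using assms(6) mn(2) by (rule path_ghost_expand[symmetric])
  finally show ?thesis .
qed

section \<open>Spanning\<close>

lemma kp_scale_add_right: "kp_scale a (x + y) = kp_scale a x + kp_scale a y"
  by transfer (rule alg_eq.scale_add)

lemma kp_scale_add_left: "kp_scale (a + b) x = kp_scale a x + kp_scale b x"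
  by transfer (rule alg_eq.add_scale)

lemma kp_scale_scale: "kp_scale a (kp_scale b x) = kp_scale (a * b) x"
  by transfer (rule alg_eq.scale_scale)

lemma kp_scale_one [simp]: "kp_scale 1 x = x"
  by transfer (rule alg_eq.scale_one)

lemma kp_scale_zero [simp]: "kp_scale a 0 = 0" "kp_scale 0 x = 0"
  using kp_scale_add_right[of a 0 0] kp_scale_add_left[of 0 0 x] by simp_all

lemma kp_scale_minus_one: "kp_scale (- 1) x = - x"
  using kp_scale_add_left[of "1" "-1" x] by (simp add: eq_neg_iff_add_eq_0 add.commute)

lemma kp_scale_mult: "kp_scale a x * y = kp_scale a (x * y)" "x * kp_scale a y = kp_scale a (x * y)"
  by (transfer, rule alg_eq.mul_scale_left) (transfer, rule alg_eq.mul_scale_right)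

lemma kp_scale_sum: "kp_scale a (sum f J) = (\<Sum>i\<in>J. kp_scale a (f i))"
  by (induction J rule: infinite_finite_induct) (simp_all add: kp_scale_add_right)

text \<open>
  The span in the locale \<open>module\<close> is over a ring of class \<open>comm_ring_1\<close>, hence a nonzero one; this one
  includes the zero ring.
\<close>

inductive_set kp_span ::
  "('r::{comm_ring, comm_monoid_mult}, 'k::finite, 'l::finite) kp set \<Rightarrow> ('r, 'k, 'l) kp set"
  for B where
  base: "x \<in> B \<Longrightarrow> x \<in> kp_span B"
| zero: "0 \<in> kp_span B"
| add: "x \<in> kp_span B \<Longrightarrow> y \<in> kp_span B \<Longrightarrow> x + y \<in> kp_span B"
| scale: "x \<in> kp_span B \<Longrightarrow> kp_scale a x \<in> kp_span B"

lemma kp_span_minus: "x \<in> kp_span B \<Longrightarrow> - x \<in> kp_span B"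
  using kp_span.scale[of x B "-1"] by (simp add: kp_scale_minus_one)

lemma kp_span_diff: "x \<in> kp_span B \<Longrightarrow> y \<in> kp_span B \<Longrightarrow> x - y \<in> kp_span B"
  using kp_span.add[of x B "- y"] by (simp add: kp_span_minus)

lemma kp_span_sum: "(\<And>i. i \<in> J \<Longrightarrow> f i \<in> kp_span B) \<Longrightarrow> sum f J \<in> kp_span B"
  by (induction J rule: infinite_finite_induct) (auto intro: kp_span.intros)

lemma kp_span_subset: "B \<subseteq> kp_span C \<Longrightarrow> kp_span B \<subseteq> kp_span C"
proof
  fix x assume "B \<subseteq> kp_span C" "x \<in> kp_span B"
  from this(2,1) show "x \<in> kp_span C" by induction (auto intro: kp_span.intros)
qed

lemma kp_span_image_finite_sum:
  assumes "x \<in> kp_span (b ` I)"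
  obtains J c where "finite J" "J \<subseteq> I" "x = (\<Sum>i\<in>J. kp_scale (c i) (b i))"
proof -
  have "\<exists>J c. finite J \<and> J \<subseteq> I \<and> x = (\<Sum>i\<in>J. kp_scale (c i) (b i))"
    using assms
  proof induction
    case (base x)
    then obtain i where "i \<in> I" "x = b i" by blast
    then show ?case by (intro exI[of _ "{i}"] exI[of _ "\<lambda>_. 1"]) simp
  next
    case zero
    show ?case by (intro exI[of _ "{}"]) simp
  next
    case (add x y)
    then obtain J c K d where
      J: "finite J" "J \<subseteq> I" "x = (\<Sum>i\<in>J. kp_scale (c i) (b i))" and
      K: "finite K" "K \<subseteq> I" "y = (\<Sum>i\<in>K. kp_scale (d i) (b i))"
      by blast
    have "x = (\<Sum>i\<in>J \<union> K. kp_scale (if i \<in> J then c i else 0) (b i))"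
      unfolding J(3) using J K by (intro sum.mono_neutral_cong_left) auto
    moreover have "y = (\<Sum>i\<in>J \<union> K. kp_scale (if i \<in> K then d i else 0) (b i))"
      unfolding K(3) using J K by (intro sum.mono_neutral_cong_left) auto
    ultimately have "x + y =
      (\<Sum>i\<in>J \<union> K. kp_scale ((if i \<in> J then c i else 0) + (if i \<in> K then d i else 0)) (b i))"
      by (simp only: kp_scale_add_left sum.distrib)
    then show ?case using J K
      by (intro exI[of _ "J \<union> K"]
          exI[of _ "\<lambda>i. (if i \<in> J then c i else 0) + (if i \<in> K then d i else 0)"]) simp
  next
    case (scale x a)
    then obtain J c where "finite J" "J \<subseteq> I" "x = (\<Sum>i\<in>J. kp_scale (c i) (b i))" by blast
    then show ?case
      by (intro exI[of _ J] exI[of _ "\<lambda>i. a * c i"]) (simp add: kp_scale_sum kp_scale_scale)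
  qed
  then show ?thesis using that by blast
qed

definition path_ghost_products :: "('r::{comm_ring, comm_monoid_mult}, 'k::finite, 'l::finite) kp set" where
  "path_ghost_products = {kp_path \<alpha> * kp_ghost \<mu> | \<alpha> \<mu>. src \<alpha> = src \<mu>}"

lemma path_ghost_productsI: "src \<alpha> = src \<mu> \<Longrightarrow> kp_path \<alpha> * kp_ghost \<mu> \<in> path_ghost_products"
  by (auto simp: path_ghost_products_def)

lemma path_in_span: "kp_path \<alpha> \<in> kp_span path_ghost_products"
  using path_ghost_productsI[of \<alpha> "idpath (src \<alpha>)"] by (auto simp: path_mult_src intro: kp_span.base)

lemma ghost_in_span: "kp_ghost \<alpha> \<in> kp_span path_ghost_products"
  using path_ghost_productsI[of "idpath (src \<alpha>)" \<alpha>] by (auto simp: src_mult_ghost intro: kp_span.base)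

lemma path_mult_in_span:
  assumes "g \<in> path_ghost_products"
  shows "kp_path \<beta> * g \<in> kp_span path_ghost_products"
proof -
  obtain \<alpha> \<mu> where g: "g = kp_path \<alpha> * kp_ghost \<mu>" "src \<alpha> = src \<mu>"
    using assms by (auto simp: path_ghost_products_def)
  show ?thesis
  proof (cases "src \<beta> = rng \<alpha>")
    case True
    then have "kp_path \<beta> * g = kp_path (\<beta> \<cdot> \<alpha>) * kp_ghost \<mu>" "src (\<beta> \<cdot> \<alpha>) = src \<mu>"
      by (simp_all add: g path_mult_path src_pcomp flip: mult.assoc)
    then show ?thesis by (auto intro: kp_span.base path_ghost_productsI)
  next
    case False
    then have "kp_path \<beta> * g = 0"
      by (simp add: g path_mult_path_zero flip: mult.assoc)
    then show ?thesis by (simp add: kp_span.zero)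
  qed
qed

text \<open>
  If the ranges agree, \<open>\<beta>\<^sup>*\<close> and \<open>\<alpha>\<mu>\<^sup>*\<close> are expanded so that the new sources coincide. Then the inner
  factors have equal degree, and (KP3) reduces each summand to zero or to a single product.
\<close>

lemma ghost_mult_in_span:
  assumes "g \<in> path_ghost_products"
  shows "kp_ghost \<beta> * g \<in> kp_span path_ghost_products"
proof -
  obtain \<alpha> \<mu> where g: "g = kp_path \<alpha> * kp_ghost \<mu>" "src \<alpha> = src \<mu>"
    using assms by (auto simp: path_ghost_products_def)
  show ?thesis
  proof (cases "rng \<beta> = rng \<alpha>")
    case rng: True
    define u where "u = (\<chi> i. min (src \<alpha> $ i) (src \<beta> $ i))"
    define m n where "m = src \<beta> - u" and "n = src \<alpha> - u"
    have mn: "m \<in> Nk" "n \<in> Nk"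
      by (auto simp: m_def n_def u_def Nk_def less_eq_vec_def)
    have "kp_ghost \<beta> = kp_path (idpath (src \<beta>)) * kp_ghost \<beta>"
      by (simp add: src_mult_ghost)
    also have "\<dots> = (\<Sum>\<nu>\<in>paths_from (src \<beta>) m. kp_path (idpath (src \<beta>) \<cdot> \<nu>) * kp_ghost (\<beta> \<cdot> \<nu>))"
      using path_ghost_expand[of "idpath (src \<beta>)" \<beta>] mn by simp
    finally have \<beta>: "kp_ghost \<beta> =
      (\<Sum>\<nu>\<in>paths_from (src \<beta>) m. kp_path (idpath (src \<beta>) \<cdot> \<nu>) * kp_ghost (\<beta> \<cdot> \<nu>))" .
    have "kp_ghost \<beta> * g = (\<Sum>\<nu>\<in>paths_from (src \<beta>) m. \<Sum>\<nu>'\<in>paths_from (src \<alpha>) n.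
        kp_path (idpath (src \<beta>) \<cdot> \<nu>) * (kp_ghost (\<beta> \<cdot> \<nu>) * kp_path (\<alpha> \<cdot> \<nu>')) * kp_ghost (\<mu> \<cdot> \<nu>'))"
      unfolding g(1) path_ghost_expand[OF g(2) mn(2)] \<beta> by (simp add: sum_product mult.assoc)
    also have "\<dots> \<in> kp_span path_ghost_products"
    proof (intro kp_span_sum)
      fix \<nu> \<nu>' :: "('b, 'c) path"
      assume \<nu>: "\<nu> \<in> paths_from (src \<beta>) m" "\<nu>' \<in> paths_from (src \<alpha>) n"
      then have sel: "rng \<nu> = src \<beta>" "src \<nu> = u" "rng \<nu>' = src \<alpha>" "src \<nu>' = u"
        by (auto simp: paths_from_def m_def n_def deg_def)
      then have "deg (\<beta> \<cdot> \<nu>) = deg (\<alpha> \<cdot> \<nu>')"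
        using rng by (simp add: deg_def rng_pcomp src_pcomp)
      then have "kp_path (idpath (src \<beta>) \<cdot> \<nu>) * (kp_ghost (\<beta> \<cdot> \<nu>) * kp_path (\<alpha> \<cdot> \<nu>')) * kp_ghost (\<mu> \<cdot> \<nu>')
        = (if \<beta> \<cdot> \<nu> = \<alpha> \<cdot> \<nu>' then kp_path \<nu> * kp_vertex (src (\<beta> \<cdot> \<nu>)) * kp_ghost (\<mu> \<cdot> \<nu>') else 0)"
        using sel by (simp add: ghost_mult_path)
      also have "\<dots> = (if \<beta> \<cdot> \<nu> = \<alpha> \<cdot> \<nu>' then kp_path \<nu> * kp_ghost (\<mu> \<cdot> \<nu>') else 0)"
        using sel by (simp add: src_pcomp path_mult_vertex)
      also have "\<dots> \<in> kp_span path_ghost_products"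
        using sel g(2) by (auto intro!: kp_span.zero kp_span.base path_ghost_productsI simp: src_pcomp)
      finally show "kp_path (idpath (src \<beta>) \<cdot> \<nu>) * (kp_ghost (\<beta> \<cdot> \<nu>) * kp_path (\<alpha> \<cdot> \<nu>')) * kp_ghost (\<mu> \<cdot> \<nu>')
        \<in> kp_span path_ghost_products" .
    qed
    finally show ?thesis .
  next
    case False
    then have "kp_ghost \<beta> * g = 0"
      by (simp add: g ghost_mult_path_zero flip: mult.assoc)
    then show ?thesis by (simp add: kp_span.zero)
  qed
qed

lemma mult_span_closed:
  assumes "\<And>g. g \<in> B \<Longrightarrow> x * g \<in> kp_span B" "g \<in> kp_span B"
  shows "x * g \<in> kp_span B"
  using assms(2) by induction (auto simp: ring_distribs kp_scale_mult intro: assms(1) kp_span.intros)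

text \<open>
  The induction on a term \<open>t\<close> carries along that left multiplication by \<open>t\<close> preserves the span. This makes
  the case of products an instance of associativity, and only generators have to be multiplied out.
\<close>

lemma path_ghost_products_span:
  "x \<in> kp_span (path_ghost_products :: ('r::{comm_ring, comm_monoid_mult}, 'k::finite, 'l::finite) kp set)"
proof -
  let ?B = "path_ghost_products :: ('r, 'k, 'l) kp set"
  have gen: "abs_kp (Gen g) \<in> range kp_path \<union> range (kp_ghost :: _ \<Rightarrow> ('r, 'k, 'l) kp)" for g
  proof (cases g)
    case (Abs_generator s)
    then consider \<alpha> where "s = Path \<alpha>" | \<alpha> where "s = Ghost \<alpha>" "\<alpha> \<in> nonzero_paths" by blast
    then show ?thesis
    proof cases
      case 1
      then have "abs_kp (Gen g) = (kp_path \<alpha> :: ('r, 'k, 'l) kp)"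
        by (simp add: Abs_generator kp_path_def path_term_def)
      then show ?thesis by blast
    next
      case 2
      then have "abs_kp (Gen g) = (kp_ghost \<alpha> :: ('r, 'k, 'l) kp)"
        by (simp add: Abs_generator kp_ghost_def ghost_term_def nonzero_paths_def)
      then show ?thesis by blast
    qed
  qed
  have "abs_kp t \<in> kp_span ?B \<and> (\<forall>y\<in>kp_span ?B. abs_kp t * y \<in> kp_span ?B)" for t
  proof (induction t)
    case (Gen g)
    have "abs_kp (Gen g) \<in> kp_span ?B" "\<And>y. y \<in> ?B \<Longrightarrow> abs_kp (Gen g) * y \<in> kp_span ?B"
      using gen[of g] path_in_span ghost_in_span path_mult_in_span ghost_mult_in_span by auto
    then show ?case by (blast intro: mult_span_closed)
  next
    case Zero
    have "abs_kp Zero = (0 :: ('r, 'k, 'l) kp)" by (simp add: zero_kp_def)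
    then show ?case by (simp add: kp_span.zero)
  next
    case (Neg t)
    then show ?case by (simp add: kp_span_minus flip: uminus_kp.abs_eq)
  next
    case (Add s t)
    then show ?case by (simp add: kp_span.add ring_distribs flip: plus_kp.abs_eq)
  next
    case (Scale a t)
    then show ?case by (simp add: kp_span.scale kp_scale_mult flip: kp_scale.abs_eq)
  next
    case (Mul s t)
    then show ?case by (simp add: mult.assoc flip: times_kp.abs_eq)
  qed
  then show ?thesis by (induction x rule: kp.abs_induct) simp
qed

text \<open>
  A pair outside \<open>A_set\<close> with nonzero degrees is \<open>\<alpha>'\<epsilon>, \<mu>'\<epsilon>\<close> for an edge \<open>\<epsilon>\<close> of label \<open>1\<close>. Expanding the
  shorter product \<open>\<alpha>'\<mu>'\<^sup>*\<close> by (KP4) in the degree of \<open>\<epsilon>\<close> expresses \<open>\<alpha>\<mu>\<^sup>*\<close> by \<open>\<alpha>'\<mu>'\<^sup>*\<close> and by products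
  of paths whose last label is not \<open>1\<close>, which lie in \<open>A_set\<close>.
\<close>

lemma path_ghost_in_basis_span:
  fixes T :: "(('k::finite, 'l::finite) path \<times> ('k, 'l) path) set"
  assumes T: "is_transversal T" and "src \<alpha> = src \<mu>"
  shows "kp_path \<alpha> * kp_ghost \<mu> \<in>
    (kp_span (basis_element ` basis_indices T) :: ('r::{comm_ring, comm_monoid_mult}, 'k, 'l) kp set)"
  using assms(2)
proof (induction "length (labels \<alpha>)" arbitrary: \<alpha> \<mu> rule: less_induct)
  case less
  let ?S = "kp_span (basis_element ` basis_indices T) :: ('r, 'k, 'l) kp set"
  have basis: "basis_element i \<in> ?S" if "i \<in> basis_indices T" for i
    using that by (intro kp_span.base imageI)
  have A: "kp_path \<beta> * kp_ghost \<gamma> \<in> ?S" if \<beta>\<gamma>: "(\<beta>, \<gamma>) \<in> A_set" for \<beta> \<gamma>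
  proof -
    obtain \<beta>' \<gamma>' where T': "(\<beta>', \<gamma>') \<in> T" "((\<beta>, \<gamma>), (\<beta>', \<gamma>')) \<in> A_sim"
      using transversal_representative[OF T \<beta>\<gamma>] by (metis surj_pair)
    have "kp_path \<beta> * kp_ghost \<gamma> = (kp_path \<beta>' * kp_ghost \<gamma>' :: ('r, 'k, 'l) kp)"
      using A_sim_imp_same_labels[OF T'(2)] by (rule path_ghost_eq_if_same_labels)
    moreover have "kp_path \<beta>' * kp_ghost \<gamma>' \<in> ?S"
      using basis[of "Pair_index \<beta>' \<gamma>'"] T'(1) by (auto simp: basis_indices_def)
    ultimately show ?thesis by simp
  qed
  show ?case
  proof (cases \<alpha> rule: path_deg_cases)
    case (1 v)
    then have *: "kp_path \<alpha> * kp_ghost \<mu> = (kp_ghost \<mu> :: ('r, 'k, 'l) kp)"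
      using less.prems src_mult_ghost[of \<mu>] by simp
    show ?thesis
    proof (cases \<mu> rule: path_deg_cases)
      case (1 w)
      then show ?thesis
        using basis[of "Vertex_index w"] unfolding * by (simp add: basis_indices_def)
    next
      case 2
      then show ?thesis
        using basis[of "Ghost_index \<mu>"] unfolding * by (simp add: basis_indices_def)
    qed
  next
    case \<alpha>: 2
    show ?thesis
    proof (cases \<mu> rule: path_deg_cases)
      case (1 w)
      then have "kp_path \<alpha> * kp_ghost \<mu> = (kp_path \<alpha> :: ('r, 'k, 'l) kp)"
        using less.prems path_mult_src[of \<alpha>] by simp
      then show ?thesis
        using basis[of "Path_index \<alpha>"] \<alpha> by (simp add: basis_indices_def)
    next
      case \<mu>: 2
      show ?thesis
      proof (cases "(\<alpha>, \<mu>) \<in> A_set")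
        case True
        then show ?thesis by (rule A)
      next
        case False
        have "(\<alpha>, \<mu>) \<in> A_hat" using \<alpha> \<mu> less.prems by (simp add: A_hat_def)
        then obtain i \<alpha>' \<mu>' where eq: "\<alpha> = extend \<alpha>' (axis i 1)" "\<mu> = extend \<mu>' (axis i 1)"
          using False by (rule not_in_A_setE)
        let ?n = "axis i 1 :: int ^ 'k"
        have n: "?n \<in> Nk" using axis_in_Nk[of i] by simp
        have src: "src \<alpha>' = src \<mu>'" using less.prems n by (simp add: eq extend_sel)
        let ?\<epsilon> = "onepath (src \<alpha>') ?n :: ('k, 'l) path"
        have \<epsilon>: "?\<epsilon> \<in> paths_from (src \<alpha>') ?n"
          using n by (simp add: paths_from_def rng_onepath deg_onepath)
        have "kp_path \<alpha>' * kp_ghost \<mu>' = (kp_path \<alpha> * kp_ghost \<mu> :: ('r, 'k, 'l) kp) +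
          (\<Sum>\<nu>\<in>paths_from (src \<alpha>') ?n - {?\<epsilon>}. kp_path (\<alpha>' \<cdot> \<nu>) * kp_ghost (\<mu>' \<cdot> \<nu>))"
          unfolding path_ghost_expand[OF src n] sum.remove[OF finite_paths_from \<epsilon>]
          by (simp add: eq src)
        moreover have "kp_path \<alpha>' * kp_ghost \<mu>' \<in> ?S"
          using src n by (intro less.hyps) (auto simp: eq extend_sel)
        moreover have "kp_path (\<alpha>' \<cdot> \<nu>) * kp_ghost (\<mu>' \<cdot> \<nu>) \<in> ?S"
          if \<nu>: "\<nu> \<in> paths_from (src \<alpha>') ?n - {?\<epsilon>}" for \<nu>
        proof (rule A)
          have rng: "rng \<nu> = src \<alpha>'" and deg: "deg \<nu> = ?n" using \<nu> by (auto simp: paths_from_def)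
          have "src \<nu> = src \<alpha>' - ?n" unfolding rng[symmetric] deg[symmetric] deg_def by simp
          have "length (labels \<nu>) = 1" using deg length_labels[of \<nu>] by simp
          then obtain a where a: "labels \<nu> = [a]" by (auto simp: length_Suc_conv)
          have "a \<noteq> 1"
          proof
            assume "a = 1"
            then have "\<nu> = ?\<epsilon>"
              using rng n a \<open>src \<nu> = src \<alpha>' - ?n\<close>
              by (intro path_eqI) (auto simp: rng_onepath onepath_sel)
            then show False using \<nu> by simp
          qed
          then show "(\<alpha>' \<cdot> \<nu>, \<mu>' \<cdot> \<nu>) \<in> A_set"
            using rng src a by (intro A_setI_last) (auto simp: src_pcomp labels_pcomp)
        qed
        ultimately show ?thesis
          using kp_span_diff[of "kp_path \<alpha>' * kp_ghost \<mu>'" "basis_element ` basis_indices T"]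
          by (metis (no_types, lifting) add_diff_cancel_right' kp_span_sum)
      qed
    qed
  qed
qed

section \<open>The boundary path representation\<close>

text \<open>
  A sequence outside \<open>streams {1..CARD('l)}\<close> is not the label sequence of an infinite path, and functions
  in the image of an action vanish there; without this (KP4) would fail.
\<close>

primrec act :: "('k::finite, 'l::finite) symbol \<Rightarrow> (int ^ 'k \<Rightarrow> nat stream \<Rightarrow> 'r)
    \<Rightarrow> int ^ 'k \<Rightarrow> nat stream \<Rightarrow> 'r::{comm_ring, comm_monoid_mult}" where
  "act (Path \<alpha>) f v x =
    (if v = rng \<alpha> \<and> x \<in> streams {1..CARD('l)} \<and> stake (length (labels \<alpha>)) x = labels \<alpha>
     then f (src \<alpha>) (sdrop (length (labels \<alpha>)) x) else 0)"
| "act (Ghost \<alpha>) f v x =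
    (if v = src \<alpha> \<and> x \<in> streams {1..CARD('l)} then f (rng \<alpha>) (labels \<alpha> @- x) else 0)"

primrec interp :: "('r, ('k::finite, 'l::finite) generator) alg_term \<Rightarrow> (int ^ 'k \<Rightarrow> nat stream \<Rightarrow> 'r)
    \<Rightarrow> int ^ 'k \<Rightarrow> nat stream \<Rightarrow> 'r::{comm_ring, comm_monoid_mult}" where
  "interp (Gen g) f = act (Rep_generator g) f"
| "interp Zero f = (\<lambda>v x. 0)"
| "interp (Neg s) f = (\<lambda>v x. - interp s f v x)"
| "interp (Add s t) f = (\<lambda>v x. interp s f v x + interp t f v x)"
| "interp (Scale a s) f = (\<lambda>v x. a * interp s f v x)"
| "interp (Mul s t) f = interp s (interp t f)"

lemma act_linear:
  "act s (\<lambda>v x. f v x + g v x) = (\<lambda>v x. act s f v x + act s g v x)"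
  "act s (\<lambda>v x. a * f v x) = (\<lambda>v x. a * act s f v x)"
  by (cases s; auto simp: fun_eq_iff)+

lemma interp_add: "interp t (\<lambda>v x. f v x + g v x) = (\<lambda>v x. interp t f v x + interp t g v x)"
  by (induction t arbitrary: f g) (simp_all add: act_linear algebra_simps)

lemma interp_scale: "interp t (\<lambda>v x. a * f v x) = (\<lambda>v x. a * interp t f v x)"
  by (induction t arbitrary: f) (simp_all add: act_linear algebra_simps)

lemma interp_path_term: "interp (path_term \<alpha>) f = act (Path \<alpha>) f"
  by (simp add: path_term_def Abs_generator_inverse)

lemma interp_ghost_term: "interp (ghost_term \<alpha>) f = act (Ghost \<alpha>) f"
proof (cases \<alpha> rule: path_deg_cases)
  case (1 v)
  then show ?thesis
    by (simp add: ghost_term_def Abs_generator_inverse fun_eq_iff)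
next
  case 2
  then show ?thesis
    by (simp add: ghost_term_def Abs_generator_inverse nonzero_paths_def)
qed

lemma shift_in_streams_iff: "xs @- x \<in> streams A \<longleftrightarrow> set xs \<subseteq> A \<and> x \<in> streams A"
  by (auto simp: streams_iff_sset)

lemma sdrop_in_streams: "x \<in> streams A \<Longrightarrow> sdrop n x \<in> streams A"
  using shift_in_streams_iff[of "stake n x" "sdrop n x" A] by (simp add: stake_sdrop)

lemma stake_append_iff:
  "stake (length p + length q) x = p @ q \<longleftrightarrow>
    stake (length p) x = p \<and> stake (length q) (sdrop (length p) x) = q"
  by (simp flip: stake_add)

lemma act_path_ghost:
  fixes \<alpha> \<mu> :: "('k::finite, 'l::finite) path"
  assumes "src \<alpha> = src \<mu>"
  shows "act (Path \<alpha>) (act (Ghost \<mu>) f) v x =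
    (if v = rng \<alpha> \<and> x \<in> streams {1..CARD('l)} \<and> stake (length (labels \<alpha>)) x = labels \<alpha>
     then f (rng \<mu>) (labels \<mu> @- sdrop (length (labels \<alpha>)) x) else 0)"
  using assms by (auto simp: sdrop_in_streams)

lemma interp_Sum_list: "interp (Sum_list ts) f v x = (\<Sum>t\<leftarrow>ts. interp t f v x)"
  by (induction ts) simp_all

lemma act_ghost_path:
  fixes \<alpha> \<mu> :: "('k::finite, 'l::finite) path"
  assumes "deg \<alpha> = deg \<mu>"
  shows "act (Ghost \<alpha>) (act (Path \<mu>) f) =
    (if \<alpha> = \<mu> then act (Path (idpath (src \<alpha>) :: ('k, 'l) path)) f else (\<lambda>v x. 0))"
proof (intro ext)
  fix v x
  have len: "length (labels \<alpha>) = length (labels \<mu>)"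
    using length_labels[of \<alpha>] length_labels[of \<mu>] assms by simp
  have eq: "\<alpha> = \<mu> \<longleftrightarrow> rng \<alpha> = rng \<mu> \<and> labels \<alpha> = labels \<mu>"
    using assms by (auto intro!: path_eqI simp: deg_def)
  show "act (Ghost \<alpha>) (act (Path \<mu>) f) v x =
      (if \<alpha> = \<mu> then act (Path (idpath (src \<alpha>) :: ('k, 'l) path)) f else (\<lambda>v x. 0)) v x"
  proof (cases "\<alpha> = \<mu>")
    case True
    then show ?thesis
      using set_labels[of \<mu>] by (auto simp: shift_in_streams_iff stake_shift sdrop_shift)
  next
    case False
    then have "rng \<alpha> \<noteq> rng \<mu> \<or> labels \<alpha> \<noteq> labels \<mu>" by (simp add: eq)
    then show ?thesis
      using False len by (auto simp: stake_shift)
  qed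
qed

text \<open>
  Exactly one path of degree \<open>n\<close> is an initial segment of the infinite path \<open>(v, x)\<close>; the other summands
  vanish at it.
\<close>

lemma act_vertex_expand:
  fixes f :: "int ^ 'k::finite \<Rightarrow> nat stream \<Rightarrow> 'r::{comm_ring, comm_monoid_mult}"
  assumes n: "n \<in> Nk"
  shows "act (Path (idpath v :: ('k, 'l::finite) path)) f w x =
    (\<Sum>\<alpha>\<in>(paths_from v n :: ('k, 'l) path set). act (Path \<alpha>) (act (Ghost \<alpha>) f) w x)"
proof (cases "w = v \<and> x \<in> streams {1..CARD('l)}")
  case True
  let ?N = "nat (vsize n)"
  define \<beta> :: "('k, 'l) path" where "\<beta> = mk_path v (v - n) (stake ?N x)"
  have \<beta>: "rng \<beta> = v" "src \<beta> = v - n" "labels \<beta> = stake ?N x"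
  proof -
    have "0 \<le> vsize n" using n vsize_mono[of 0 n] by (simp add: Nk_def)
    moreover have "set (stake ?N x) \<subseteq> {1..CARD('l)}"
      using True shift_in_streams_iff[of "stake ?N x" "sdrop ?N x"] by (simp add: stake_sdrop)
    moreover have "v - n \<le> v" using n by (simp add: Nk_def less_eq_vec_def)
    ultimately show "rng \<beta> = v" "src \<beta> = v - n" "labels \<beta> = stake ?N x"
      using mk_path_sel[of "v - n" v "stake ?N x", where 'l = 'l] by (simp_all add: \<beta>_def)
  qed
  have in_paths: "\<beta> \<in> paths_from v n" using \<beta> by (simp add: paths_from_def deg_def)
  have "act (Path \<alpha>) (act (Ghost \<alpha>) f) w x = (if \<alpha> = \<beta> then f v x else 0)"
    if \<alpha>: "\<alpha> \<in> paths_from v n" for \<alpha> :: "('k, 'l) path"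
  proof -
    have len: "length (labels \<alpha>) = ?N" using \<alpha> length_labels[of \<alpha>] by (simp add: paths_from_def)
    have "\<alpha> = \<beta> \<longleftrightarrow> stake ?N x = labels \<alpha>"
      using \<alpha> \<beta> by (auto intro!: path_eqI simp: paths_from_def deg_def)
    then show ?thesis
      using \<alpha> True len stake_sdrop[of ?N x] by (auto simp: act_path_ghost paths_from_def simp del: act.simps)
  qed
  then have "(\<Sum>\<alpha>\<in>(paths_from v n :: ('k, 'l) path set). act (Path \<alpha>) (act (Ghost \<alpha>) f) w x)
    = (\<Sum>\<alpha>\<in>paths_from v n. if \<alpha> = \<beta> then f v x else 0)"
    by (intro sum.cong) auto
  then show ?thesis
    using True in_paths by (simp add: sum.delta finite_paths_from)
next
  case False
  then show ?thesis
    by (auto simp: paths_from_def intro!: sum.neutral[symmetric])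
qed

lemma interp_kp_rel: "kp_rel s t \<Longrightarrow> interp s f = interp t f"
proof (induction rule: kp_rel.induct)
  case (KP3 \<alpha> \<mu>)
  then show ?case
    by (simp add: interp_path_term interp_ghost_term act_ghost_path del: act.simps)
next
  case (KP4 n xs v)
  then show ?case
    using act_vertex_expand[of n v f]
    by (auto simp: fun_eq_iff interp_Sum_list interp_path_term interp_ghost_term
        sum_list_distinct_conv_sum_set comp_def simp del: act.simps)
qed (auto simp: fun_eq_iff interp_path_term interp_ghost_term rng_pcomp src_pcomp labels_pcomp
    stake_append_iff sdrop_in_streams shift_in_streams_iff set_labels[unfolded One_nat_def])

lemma interp_alg_eq: "alg_eq kp_rel s t \<Longrightarrow> interp s f = interp t f"
proof (induction arbitrary: f rule: alg_eq.induct)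
  case (rel x y)
  then show ?case by (rule interp_kp_rel)
qed (simp_all add: interp_add interp_scale algebra_simps)

lift_definition kp_op :: "('r, 'k::finite, 'l::finite) kp \<Rightarrow> (int ^ 'k \<Rightarrow> nat stream \<Rightarrow> 'r)
    \<Rightarrow> int ^ 'k \<Rightarrow> nat stream \<Rightarrow> 'r::{comm_ring, comm_monoid_mult}" is interp
  using interp_alg_eq by blast

lemma kp_op_zero: "kp_op 0 f v x = 0"
  by transfer simp

lemma kp_op_add: "kp_op (a + b) f v x = kp_op a f v x + kp_op b f v x"
  by transfer simp

lemma kp_op_scale: "kp_op (kp_scale c a) f v x = c * kp_op a f v x"
  by transfer simp

lemma kp_op_sum: "kp_op (sum g J) f v x = (\<Sum>i\<in>J. kp_op (g i) f v x)"
  by (induction J rule: infinite_finite_induct) (simp_all add: kp_op_zero kp_op_add)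

lemma kp_op_path_ghost:
  fixes \<alpha> \<mu> :: "('k::finite, 'l::finite) path"
  assumes "src \<alpha> = src \<mu>"
  shows "kp_op (kp_path \<alpha> * kp_ghost \<mu>) f v x =
    (if v = rng \<alpha> \<and> x \<in> streams {1..CARD('l)} \<and> stake (length (labels \<alpha>)) x = labels \<alpha>
     then f (rng \<mu>) (labels \<mu> @- sdrop (length (labels \<alpha>)) x) else 0)"
  unfolding act_path_ghost[OF assms, symmetric]
  by transfer (simp add: interp_path_term interp_ghost_term del: act.simps)

section \<open>Linear independence\<close>

text \<open>
  Every basis element is of the form \<open>\<alpha>\<mu>\<^sup>*\<close> (see \<open>basis_element_eq\<close>), where \<open>\<alpha>\<close> or \<open>\<mu>\<close> may be an
  identity; this allows a uniform treatment of the four kinds.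
\<close>

fun left_path :: "('k::finite, 'l::finite) basis_index \<Rightarrow> ('k, 'l) path" where
  "left_path (Vertex_index v) = idpath v"
| "left_path (Path_index \<alpha>) = \<alpha>"
| "left_path (Ghost_index \<alpha>) = idpath (src \<alpha>)"
| "left_path (Pair_index \<alpha> \<mu>) = \<alpha>"

fun right_path :: "('k::finite, 'l::finite) basis_index \<Rightarrow> ('k, 'l) path" where
  "right_path (Vertex_index v) = idpath v"
| "right_path (Path_index \<alpha>) = idpath (src \<alpha>)"
| "right_path (Ghost_index \<alpha>) = \<alpha>"
| "right_path (Pair_index \<alpha> \<mu>) = \<mu>"

lemma basis_indices_cases:
  assumes "is_transversal T" "i \<in> basis_indices T"
  obtains v where "i = Vertex_index v"
    | \<alpha> where "i = Path_index \<alpha>" "labels \<alpha> \<noteq> []"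
    | \<alpha> where "i = Ghost_index \<alpha>" "labels \<alpha> \<noteq> []"
    | \<alpha> \<mu> where "i = Pair_index \<alpha> \<mu>" "(\<alpha>, \<mu>) \<in> T" "(\<alpha>, \<mu>) \<in> A_set" "src \<alpha> = src \<mu>"
      "labels \<alpha> \<noteq> []" "labels \<mu> \<noteq> []"
  using assms
  by (cases i) (auto simp: basis_indices_def nonzero_paths_iff is_transversal_def A_set_def A_hat_def subset_eq)

lemma src_left_right:
  assumes "is_transversal T" "i \<in> basis_indices T"
  shows "src (left_path i) = src (right_path i)"
  using assms by (cases rule: basis_indices_cases) auto

lemma basis_element_eq: "basis_element i = kp_path (left_path i) * kp_ghost (right_path i)"
  by (cases i) (simp_all add: kp_vertex_mult path_mult_src src_mult_ghost)

text \<open>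
  Within each kind this is clear except for pairs, where the two are related by \<open>A_sim\<close> and the
  transversal property applies. The kind is determined by which of the two words are empty.
\<close>

lemma basis_index_eqI:
  assumes T: "is_transversal T" "i \<in> basis_indices T" "j \<in> basis_indices T"
    and eq: "rng (left_path i) = rng (left_path j)" "rng (right_path i) = rng (right_path j)"
      "labels (left_path i) = labels (left_path j)" "labels (right_path i) = labels (right_path j)"
  shows "i = j"
proof -
  have "\<alpha> = \<beta> \<and> \<mu> = \<nu>" if "(\<alpha>, \<mu>) \<in> T" "(\<beta>, \<nu>) \<in> T" "rng \<alpha> = rng \<beta>" "rng \<mu> = rng \<nu>"
    "labels \<alpha> = labels \<beta>" "labels \<mu> = labels \<nu>" for \<alpha> \<beta> \<mu> \<nu>
    using that T(1) transversal_unique[OF T(1) that(1,2)] A_sim_if_same_labels[of \<alpha> \<mu> \<beta> \<nu>]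
    by (auto simp: is_transversal_def)
  then show ?thesis
    using eq
    by (cases rule: basis_indices_cases[OF T(1,2)]; cases rule: basis_indices_cases[OF T(1,3)])
      (auto intro!: path_eqI)
qed

text \<open>
  The size assumption excludes all but pairs: an empty word forces the source to equal one of the ranges,
  which has at least the size of \<open>u\<close>.
\<close>

lemma basis_index_last_neq_one:
  assumes T: "is_transversal T" "i \<in> basis_indices T"
    and u: "u \<le> rng (left_path i)" "u \<le> rng (right_path i)" "vsize (src (left_path i)) < vsize u"
  shows "last (labels (left_path i)) \<noteq> 1 \<or> last (labels (right_path i)) \<noteq> 1"
proof -
  have less: "vsize (src (left_path i)) < vsize (rng (left_path i))"
    "vsize (src (left_path i)) < vsize (rng (right_path i))"
    using u(3) vsize_mono[OF u(1)] vsize_mono[OF u(2)] by simp_all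
  then obtain \<alpha> \<mu> where i: "i = Pair_index \<alpha> \<mu>" "(\<alpha>, \<mu>) \<in> A_set"
    by (cases rule: basis_indices_cases[OF T]) auto
  show ?thesis
    using i u A_set_last_neq_one[OF i(2)] by simp
qed

lemma shift_eq_imp_eq: "p @- x = q @- y \<Longrightarrow> length p = length q \<Longrightarrow> p = q"
proof -
  assume "p @- x = q @- y" "length p = length q"
  then have "stake (length p) (p @- x) = stake (length q) (q @- y)" by simp
  then show "p = q" by (simp add: stake_shift)
qed

lemma last_eq_one_if_shift_eq:
  assumes "q @- y = p @- sconst 1" "length p < length q"
  shows "last q = (1 :: nat)"
proof -
  have "last q = (q @- y) !! (length q - 1)"
    using assms(2) by (subst last_conv_nth) auto
  also have "\<dots> = 1" unfolding assms(1)
    using assms(2) snth_sset[of "sconst 1"] by (auto simp: shift_snth)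
  finally show ?thesis .
qed

theorem theorem14:
  fixes T :: "(('k::finite, 'l::finite) path \<times> ('k, 'l) path) set"
  assumes "is_transversal T"
  shows "basis_family
    (kp_scale :: 'r::{comm_ring, comm_monoid_mult} \<Rightarrow> ('r, 'k, 'l) kp \<Rightarrow> ('r, 'k, 'l) kp)
    basis_element (basis_indices T)"
  unfolding basis_family_def
proof (intro conjI allI impI)
  fix x :: "('r, 'k, 'l) kp"
  have "path_ghost_products \<subseteq> (kp_span (basis_element ` basis_indices T) :: ('r, 'k, 'l) kp set)"
    using path_ghost_in_basis_span[OF assms] by (auto simp: path_ghost_products_def)
  then have "x \<in> kp_span (basis_element ` basis_indices T)"
    using path_ghost_products_span kp_span_subset by blast
  then show "\<exists>J c. finite J \<and> J \<subseteq> basis_indices T \<and> x = (\<Sum>i\<in>J. kp_scale (c i) (basis_element i))"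
    by (rule kp_span_image_finite_sum) blast
next
  fix J :: "('k, 'l) basis_index set" and c :: "('k, 'l) basis_index \<Rightarrow> 'r"
  assume J: "finite J" "J \<subseteq> basis_indices T"
    and zero: "(\<Sum>i\<in>J. kp_scale (c i) (basis_element i) :: ('r, 'k, 'l) kp) = 0"
  show "\<forall>i\<in>J. c i = 0"
  proof (rule ccontr)
    assume "\<not> ?thesis"
    then have nz: "finite {i \<in> J. c i \<noteq> 0}" "{i \<in> J. c i \<noteq> 0} \<noteq> {}" using J by auto
    let ?h = "\<lambda>i :: ('k, 'l) basis_index. vsize (src (left_path i))"
    have "Max (?h ` {i \<in> J. c i \<noteq> 0}) \<in> ?h ` {i \<in> J. c i \<noteq> 0}"
      using nz by (intro Max_in) auto
    then obtain i where i: "i \<in> J" "c i \<noteq> 0" and Max: "Max (?h ` {i \<in> J. c i \<noteq> 0}) = ?h i"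
      by auto
    have max: "?h j \<le> ?h i" if "j \<in> J" "c j \<noteq> 0" for j
      unfolding Max[symmetric] using nz that by (intro Max_ge) auto
    let ?x = "labels (left_path i) @- sconst 1" and ?y = "labels (right_path i) @- sconst 1"
    \<comment> \<open>Applying an operator to the indicator function \<open>f\<close> of one point and evaluating at another point
      reads off a matrix entry.\<close>
    define f :: "int ^ 'k \<Rightarrow> nat stream \<Rightarrow> 'r" where
      "f = (\<lambda>v x. if v = rng (right_path i) \<and> x = ?y then 1 else 0)"
    have x: "?x \<in> streams {1..CARD('l)}"
      using set_labels[of "left_path i"] by (auto simp: shift_in_streams_iff sconst_streams Suc_le_eq)
    have *: "c j * kp_op (basis_element j) f (rng (left_path i)) ?x = (if j = i then c i else 0)"
      if j: "j \<in> J" for j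
    proof (cases "j = i")
      case True
      then show ?thesis
        using x i J src_left_right[OF assms, of i]
        by (auto simp: basis_element_eq kp_op_path_ghost f_def stake_shift sdrop_shift)
    next
      case False
      have ij: "i \<in> basis_indices T" "j \<in> basis_indices T" using i j J by auto
      note src = src_left_right[OF assms ij(1)] src_left_right[OF assms ij(2)]
      have "c j = 0 \<or> kp_op (basis_element j) f (rng (left_path i)) ?x = 0"
      proof (rule ccontr)
        assume contr: "\<not> ?thesis"
        let ?p = "labels (left_path j)" and ?q = "labels (right_path j)"
        define z where "z = sdrop (length ?p) ?x"
        have rng: "rng (left_path j) = rng (left_path i)" "rng (right_path j) = rng (right_path i)"
          and stake: "stake (length ?p) ?x = ?p" and q: "?q @- z = ?y"
          using contr src(2)
          by (auto simp: basis_element_eq kp_op_path_ghost f_def z_def split: if_splits)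
        have p: "?p @- z = ?x" using stake stake_sdrop[of "length ?p" ?x] by (simp add: z_def)
        have le: "vsize (src (left_path j)) \<le> vsize (src (left_path i))" using contr max j by blast
        note len = length_labels_eq[of "left_path i"] length_labels_eq[of "left_path j"]
          length_labels_eq[of "right_path i"] length_labels_eq[of "right_path j"]
        show False
        proof (cases "vsize (src (left_path j)) = vsize (src (left_path i))")
          case True
          then have "length ?p = length (labels (left_path i))" "length ?q = length (labels (right_path i))"
            using len src rng by simp_all
          then have "?p = labels (left_path i)" "?q = labels (right_path i)"
            using p q shift_eq_imp_eq by metis+
          then have "j = i" using basis_index_eqI[OF assms ij(2,1) rng] by simp
          then show False using False by simp
        next
          case False
          then have "length (labels (left_path i)) < length ?p" "length (labels (right_path i)) < length ?q"
            using le len src rng by simp_all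
          then have "last ?p = 1" "last ?q = 1"
            using last_eq_one_if_shift_eq[OF p] last_eq_one_if_shift_eq[OF q] by blast+
          moreover have "src (left_path i) \<le> rng (left_path j)" "src (left_path i) \<le> rng (right_path j)"
            using rng src src_le_rng by metis+
          ultimately show False
            using basis_index_last_neq_one[OF assms ij(2), of "src (left_path i)"] le False by simp
        qed
      qed
      then show ?thesis using False by auto
    qed
    have "0 = kp_op (\<Sum>j\<in>J. kp_scale (c j) (basis_element j)) f (rng (left_path i)) ?x"
      by (simp add: zero kp_op_zero)
    also have "\<dots> = (\<Sum>j\<in>J. if j = i then c i else 0)"
      by (simp add: kp_op_sum kp_op_scale * del: One_nat_def cong: sum.cong)
    also have "\<dots> = c i" using i J by simp
    finally show False using i by simp
  qed
qed

end
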